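(* Let $r\ge0$, let $F_i:\mathbb{R}\times\mathbb{R}^n\to\mathbb{R}^n$ ($0\le i\le m$) be continuous mappings which are locally Lipschitz in the space variable $x$ uniformly with respect to $t$ in bounded intervals, and let $r_i:\mathbb{R}\to[0,r]$ ($1\le i\le m$) be measurable functions. Suppose there are constants $p>q\ge1$, $\alpha_i>0$ ($0\le i\le m$) and nonnegative measurable functions $\beta_i$ ($0\le i\le m$) on $\mathbb{R}$ such that for all $x\in\mathbb{R}^n$, $t\in\mathbb{R}$, $$(F_0(t,x),x)\le-\alpha_0|x|^{p+1}+\beta_0(t),\qquad |F_i(t,x)|\le\alpha_i|x|^q+\beta_i(t)\quad(1\le i\le m),$$ and that there exist $M,N>0$ such that $$\sum_{i=0}^m\int_s^t\beta_i(\mu)\,d\mu\le M(t-s)+N,\qquad -\infty<s<t<\infty .$$ Let $\Phi(t,\tau)$ be the process on $\mathcal{C}=C([-r,0],\mathbb{R}^n)$ generated by $$\dot x=F_0(t,x)+\sum_{i=1}^mF_i\big(t,x(t-r_i(t))\big),$$ and let $C,\lambda,\rho>0$ be constants such that $|x(t;\tau,\phi)|\le C\|\phi\|e^{-\lambda(t-\tau)}+\rho$ for all $t\ge\tau$ and $(\tau,\phi)\in\mathbb{R}\times\mathcal{C}$. Then $\Phi$ has a (unique) global pullback attractor in $\mathcal{C}$. Specifically, there is a unique family $\mathcal{A}=\{A(t)\}_{t\in\mathbb{R}}$ of compact sets contained in the closed ball $\overline{\mathcal{B}}_\rho$ of $\mathcal{C}$ centered at $0$ with radius $\rho$ such that (1)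 $\Phi(t,\tau)A(\tau)=A(t)$ for all $t\ge\tau$; (2) for any bounded set $B\subset\mathcal{C}$, $$\lim_{\tau\to-\infty}d_H\big(\Phi(t,\tau)B,A(t)\big)=0\qquad\text{for all }t\in\mathbb{R}.$$
   Context: $\mathcal{C}=C([-r,0],\mathbb{R}^n)$ with the sup-norm $\|\cdot\|$; $(\cdot,\cdot)$ and $|\cdot|$ are the Euclidean inner product and norm. For $(\tau,\phi)\in\mathbb{R}\times\mathcal{C}$, $x(t;\tau,\phi)$ denotes the unique solution with $x(\tau+s)=\phi(s)$, $s\in[-r,0]$; since the $r_i$ are only measurable, a solution is a continuous function satisfying the integrated form of the equation for $t\ge\tau$. Under the stated hypotheses all solutions exist for all $t\ge\tau$, and constants $C,\lambda,\rho>0$ (independent of $\tau,\phi$) as in the claim exist. The process is $\Phi(t,\tau)\phi=x_t(\tau,\phi)$, $t\ge\tau$, where $x_t(\tau,\phi)\in\mathcal{C}$ is the lift $x_t(\tau,\phi)(s)=x(t+s;\tau,\phi)$, $s\in[-r,0]$. $d_H$ is the Hausdorff semi-distance in $\mathcal{C}$: $d_H(M,N)=\sup_{\phi\in M}\inf\{\|\phi-\psi\|:\psi\in N\}$ for $M,N\subset\mathcal{C}$. *)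

theory Defs
  imports "HOL-Analysis.Analysis"
begin

section \<open>The phase space \<open>C([-r,0], \<real>\<^sup>n)\<close>\<close>

(* Elements are functions on the reals that are extensional on {-r..0} (value "undefined"
   outside), so that equality of elements is equality of functions on [-r,0]. *)
definition history_space :: "real \<Rightarrow> (real \<Rightarrow> real ^ 'n) metric" where
  "history_space r = cfunspace (top_of_set {-r..0}) euclidean_metric"

definition hist_norm :: "real \<Rightarrow> (real \<Rightarrow> real ^ 'n) \<Rightarrow> real" where
  "hist_norm r \<phi> = (SUP s\<in>{-r..0}. norm (\<phi> s))"

definition hist_cball :: "real \<Rightarrow> real \<Rightarrow> (real \<Rightarrow> real ^ 'n) set" where
  "hist_cball r \<rho> = {\<phi> \<in> mspace (history_space r). hist_norm r \<phi> \<le> \<rho>}"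

lemma mspace_history_space:
  "mspace (history_space r) = {\<phi> \<in> extensional {-r..0}. continuous_on {-r..0} \<phi>}"
proof -
  have *: "bounded (f ` {-r..0})" if "continuous_on {-r..0} f" for f :: "real \<Rightarrow> real ^ 'n"
    using compact_continuous_image[OF that] by (simp add: compact_imp_bounded)
  have **: "Metric_space.mbounded UNIV dist S \<longleftrightarrow> bounded S" for S :: "(real ^ 'n) set"
    by simp
  show ?thesis
    using * by (auto simp: history_space_def **)
qed

lemma mdist_history_space:
  assumes "r \<ge> 0" "\<phi> \<in> mspace (history_space r)" "\<psi> \<in> mspace (history_space r)"
  shows "mdist (history_space r) \<phi> \<psi> = hist_norm r (\<lambda>s. \<phi> s - \<psi> s)"
proof -
  have "\<phi> \<in> Metric_space.fspace UNIV dist {-r..0}" "\<psi> \<in> Metric_space.fspace UNIV dist {-r..0}"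
    using assms(2,3) unfolding history_space_def cfunspace_def by auto
  then show ?thesis
    using assms(1)
    by (simp add: history_space_def cfunspace_def Met_TC.fdist_def hist_norm_def dist_norm)
qed

(* Valued in ennreal, so that d_H({}, N) = 0 and d_H(M, {}) = \<infinity> for nonempty M. *)
definition hausdorff_semidist :: "'a metric \<Rightarrow> 'a set \<Rightarrow> 'a set \<Rightarrow> ennreal" where
  "hausdorff_semidist X M N = (SUP \<phi>\<in>M. INF \<psi>\<in>N. ennreal (mdist X \<phi> \<psi>))"


section \<open>The delay equation and its process\<close>

definition locally_lipschitz_space :: "(real \<Rightarrow> real ^ 'n \<Rightarrow> real ^ 'n) \<Rightarrow> bool" where
  "locally_lipschitz_space f \<longleftrightarrow>
     (\<forall>a b x. \<exists>u>0. \<exists>L. \<forall>t\<in>{a..b}. L-lipschitz_on (cball x u) (f t))"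

definition dde_rhs ::
  "nat \<Rightarrow> (nat \<Rightarrow> real \<Rightarrow> real ^ 'n \<Rightarrow> real ^ 'n) \<Rightarrow> (nat \<Rightarrow> real \<Rightarrow> real)
   \<Rightarrow> (real \<Rightarrow> real ^ 'n) \<Rightarrow> real \<Rightarrow> real ^ 'n" where
  "dde_rhs m F \<delta> x t = F 0 t (x t) + (\<Sum>i = 1..m. F i t (x (t - \<delta> i t)))"

(* A global solution lives on [\<tau> - r, \<infinity>); the delays are only measurable, so the equation is
   required in integrated form. *)
definition dde_solution ::
  "real \<Rightarrow> nat \<Rightarrow> (nat \<Rightarrow> real \<Rightarrow> real ^ 'n \<Rightarrow> real ^ 'n) \<Rightarrow> (nat \<Rightarrow> real \<Rightarrow> real)
   \<Rightarrow> real \<Rightarrow> (real \<Rightarrow> real ^ 'n) \<Rightarrow> (real \<Rightarrow> real ^ 'n) \<Rightarrow> bool" where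
  "dde_solution r m F \<delta> \<tau> \<phi> x \<longleftrightarrow>
     continuous_on {\<tau> - r..} x \<and>
     (\<forall>s\<in>{-r..0}. x (\<tau> + s) = \<phi> s) \<and>
     (\<forall>t\<ge>\<tau>. set_integrable lebesgue {\<tau>..t} (dde_rhs m F \<delta> x) \<and>
            x t = \<phi> 0 + (LINT s:{\<tau>..t}|lebesgue. dde_rhs m F \<delta> x s))"

(* x(.; \<tau>, \<phi>); extensionality on [\<tau> - r, \<infinity>) removes the arbitrary values to the left of it,
   which would otherwise destroy uniqueness. *)
definition dde_sol ::
  "real \<Rightarrow> nat \<Rightarrow> (nat \<Rightarrow> real \<Rightarrow> real ^ 'n \<Rightarrow> real ^ 'n) \<Rightarrow> (nat \<Rightarrow> real \<Rightarrow> real)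
   \<Rightarrow> real \<Rightarrow> (real \<Rightarrow> real ^ 'n) \<Rightarrow> real \<Rightarrow> real ^ 'n" where
  "dde_sol r m F \<delta> \<tau> \<phi> =
     (THE x. x \<in> extensional {\<tau> - r..} \<and> dde_solution r m F \<delta> \<tau> \<phi> x)"

definition dde_process ::
  "real \<Rightarrow> nat \<Rightarrow> (nat \<Rightarrow> real \<Rightarrow> real ^ 'n \<Rightarrow> real ^ 'n) \<Rightarrow> (nat \<Rightarrow> real \<Rightarrow> real)
   \<Rightarrow> real \<Rightarrow> real \<Rightarrow> (real \<Rightarrow> real ^ 'n) \<Rightarrow> (real \<Rightarrow> real ^ 'n)" where
  "dde_process r m F \<delta> t \<tau> \<phi> = (\<lambda>s\<in>{-r..0}. dde_sol r m F \<delta> \<tau> \<phi> (t + s))"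

end

theory Submission
  imports Defs "HOL-Complex_Analysis.Great_Picard"
begin

text \<open>
  Solutions exist globally: cutting the \<open>F i\<close> off outside a large ball makes them globally
  Lipschitz, so a contraction in an exponentially weighted norm solves the integral equation on
  any interval, and \<open>p > q\<close> keeps the truncated solution inside the ball. Indeed, if \<open>\<bar>x\<bar>\<close> first
  reaches \<open>R\<close>, then since its last visit to a level \<open>c\<close> with \<open>(\<Sum> \<alpha> i) R\<^sup>q \<le> \<alpha> 0 c\<^sup>p\<close> it has grown
  at most by the integral of the \<open>\<beta> i\<close>, which is impossible when \<open>R - c\<close> exceeds that integral.

  Within the absorbing bound given by \<open>C\<close>, \<open>lam\<close> and \<open>\<rho>\<close>, solutions started early enough are
  equi-Lipschitz on \<open>[t - r, t]\<close>, so by Arzela-Ascoli the process is pullback asymptotically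
  compact. The attractor at time \<open>t\<close> consists of all limits of \<open>\<Phi>(t, \<sigma> n) (f n)\<close> with
  \<open>\<sigma> n \<rightarrow> -\<infinity>\<close> and \<open>f\<close> bounded. It is unique because an invariant family inside the \<open>\<rho>\<close>-ball is
  attracted by any other attractor.
\<close>

section \<open>Pullback attractors of asymptotically compact processes\<close>

lemma limitin_mtopology_of_iff:
  "limitin (mtopology_of X) f l F \<longleftrightarrow>
     l \<in> mspace X \<and> (\<forall>\<^sub>F n in F. f n \<in> mspace X) \<and> ((\<lambda>n. mdist X (f n) l) \<longlongrightarrow> 0) F"
  unfolding mtopology_of_def by (rule Metric_space.limitin_metric_dist_null) simp

lemma mdist_limit_unique:
  assumes "(\<lambda>n. mdist X (f n) a) \<longlonglongrightarrow> 0" "(\<lambda>n. mdist X (f n) b) \<longlonglongrightarrow> 0"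
    and "\<forall>\<^sub>F n in sequentially. f n \<in> mspace X" "a \<in> mspace X" "b \<in> mspace X"
  shows "a = b"
proof -
  have "limitin (mtopology_of X) f a sequentially" "limitin (mtopology_of X) f b sequentially"
    using assms by (auto simp: limitin_mtopology_of_iff)
  then show ?thesis
    using Metric_space.limitin_metric_unique[OF Metric_space_mspace_mdist, of X f a sequentially b]
    by (simp add: mtopology_of_def)
qed

text \<open>\<open>size\<close> only decides which sets count as bounded; no compatibility with the
  metric is assumed. Nothing is known of \<open>U t \<tau>\<close> for \<open>\<tau> > t\<close>,
  although the sequences \<open>\<sigma>\<close> may start there, so arguments below pass to late
  indices.\<close>

locale pullback_process =
  fixes X :: "'a metric" and U :: "real \<Rightarrow> real \<Rightarrow> 'a \<Rightarrow> 'a" and size :: "'a \<Rightarrow> real" and R :: real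
  assumes nonempty: "mspace X \<noteq> {}"
    and U_closed: "\<tau> \<le> t \<Longrightarrow> \<phi> \<in> mspace X \<Longrightarrow> U t \<tau> \<phi> \<in> mspace X"
    and U_compose: "\<tau> \<le> s \<Longrightarrow> s \<le> t \<Longrightarrow> \<phi> \<in> mspace X \<Longrightarrow> U t s (U s \<tau> \<phi>) = U t \<tau> \<phi>"
    and U_continuous: "\<tau> \<le> t \<Longrightarrow> (\<And>n. f n \<in> mspace X) \<Longrightarrow> l \<in> mspace X \<Longrightarrow>
      (\<lambda>n. mdist X (f n) l) \<longlonglongrightarrow> 0 \<Longrightarrow> (\<lambda>n. mdist X (U t \<tau> (f n)) (U t \<tau> l)) \<longlonglongrightarrow> 0"
    and asymptotically_compact: "filterlim \<sigma> at_bot sequentially \<Longrightarrow> (\<And>n. f n \<in> mspace X) \<Longrightarrow>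
      (\<And>n. size (f n) \<le> K) \<Longrightarrow>
      \<exists>k l. strict_mono (k :: nat \<Rightarrow> nat) \<and> l \<in> mspace X \<and>
        (\<lambda>n. mdist X (U t (\<sigma> (k n)) (f (k n))) l) \<longlonglongrightarrow> 0"
    and limit_size: "filterlim \<sigma> at_bot sequentially \<Longrightarrow> (\<And>n. f n \<in> mspace X) \<Longrightarrow>
      (\<And>n. size (f n) \<le> K) \<Longrightarrow> l \<in> mspace X \<Longrightarrow>
      (\<lambda>n. mdist X (U t (\<sigma> n) (f n)) l) \<longlonglongrightarrow> 0 \<Longrightarrow> size l \<le> R"
begin

text \<open>This is the union of the pullback omega-limit sets of all bounded sets. No closure is
  taken: compactness is recovered from invariance in \<open>attractor_compact\<close>.\<close>

definition attractor :: "real \<Rightarrow> 'a set" where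
  "attractor t = {l \<in> mspace X. \<exists>\<sigma> f K. filterlim \<sigma> at_bot sequentially \<and> (\<forall>n. f n \<in> mspace X) \<and>
     (\<forall>n. size (f n) \<le> K) \<and> (\<lambda>n. mdist X (U t (\<sigma> n) (f n)) l) \<longlonglongrightarrow> 0}"

lemma attractorI:
  assumes "filterlim \<sigma> at_bot sequentially" "\<And>n. f n \<in> mspace X" "\<And>n. size (f n) \<le> K"
    "l \<in> mspace X" "(\<lambda>n. mdist X (U t (\<sigma> n) (f n)) l) \<longlonglongrightarrow> 0"
  shows "l \<in> attractor t"
  using assms unfolding attractor_def by blast

lemma attractorE:
  assumes "l \<in> attractor t"
  obtains \<sigma> f K where "filterlim \<sigma> at_bot sequentially" "\<And>n. f n \<in> mspace X" "\<And>n. size (f n) \<le> K"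
    "l \<in> mspace X" "(\<lambda>n. mdist X (U t (\<sigma> n) (f n)) l) \<longlonglongrightarrow> 0"
  using assms unfolding attractor_def by blast

text \<open>A subsequence of \<open>\<sigma>\<close> still tends to \<open>-\<infinity>\<close>, so
  the limit supplied by asymptotic compactness is witnessed by that very subsequence. Compactness
  enters the arguments below in this form.\<close>

lemma asymptotic_subsequence:
  assumes "filterlim \<sigma> at_bot sequentially" "\<And>n. f n \<in> mspace X" "\<And>n. size (f n) \<le> K"
  obtains k l where "strict_mono (k :: nat \<Rightarrow> nat)" "l \<in> attractor t"
    "(\<lambda>n. mdist X (U t (\<sigma> (k n)) (f (k n))) l) \<longlonglongrightarrow> 0"
proof -
  obtain k l where kl: "strict_mono (k :: nat \<Rightarrow> nat)" "l \<in> mspace X"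
      "(\<lambda>n. mdist X (U t (\<sigma> (k n)) (f (k n))) l) \<longlonglongrightarrow> 0"
    using asymptotically_compact[of \<sigma> f K t] assms by blast
  have "filterlim (\<lambda>n. \<sigma> (k n)) at_bot sequentially"
    using assms(1) filterlim_subseq[OF kl(1)] by (rule filterlim_compose)
  then have "l \<in> attractor t"
    using assms kl by (intro attractorI[of "\<lambda>n. \<sigma> (k n)" "\<lambda>n. f (k n)" K]) auto
  then show thesis
    using kl that by blast
qed

lemma attractor_subset: "attractor t \<subseteq> {l \<in> mspace X. size l \<le> R}"
  by (auto elim!: attractorE intro: limit_size)

text \<open>Pushing a defining sequence at time \<open>\<tau>\<close> forward by
  \<open>U t \<tau>\<close> gives one at time \<open>t\<close>, by continuity and the cocycle law.
  Conversely, the states at time \<open>\<tau>\<close> of a sequence defining \<open>l\<close> have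
  a cluster point \<open>\<psi>\<close>, and \<open>U t \<tau> \<psi>\<close> equals
  \<open>l\<close> because limits are unique.\<close>

lemma attractor_invariant:
  assumes "\<tau> \<le> t"
  shows "U t \<tau> ` attractor \<tau> = attractor t"
proof (intro equalityI subsetI)
  fix l assume "l \<in> U t \<tau> ` attractor \<tau>"
  then obtain \<psi> where \<psi>: "\<psi> \<in> attractor \<tau>" "l = U t \<tau> \<psi>"
    by blast
  from \<psi>(1) obtain \<sigma> f K where sf: "filterlim \<sigma> at_bot sequentially" "\<And>n. f n \<in> mspace X"
      "\<And>n. size (f n) \<le> K" "\<psi> \<in> mspace X" "(\<lambda>n. mdist X (U \<tau> (\<sigma> n) (f n)) \<psi>) \<longlonglongrightarrow> 0"
    by (rule attractorE) (rule that)
  have "\<forall>\<^sub>F n in sequentially. \<sigma> n \<le> \<tau>"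
    using sf(1) by (simp add: filterlim_at_bot)
  \<comment> \<open>Splitting an evolution at \<open>\<tau>\<close> is legitimate only when it
    starts before \<open>\<tau>\<close>, so the sequence is shifted by \<open>n0\<close>.\<close>
  then obtain n0 where n0: "\<And>n. n \<ge> n0 \<Longrightarrow> \<sigma> n \<le> \<tau>"
    by (auto simp: eventually_sequentially)
  have "(\<lambda>n. mdist X (U t \<tau> (U \<tau> (\<sigma> (n + n0)) (f (n + n0)))) (U t \<tau> \<psi>)) \<longlonglongrightarrow> 0"
    using assms sf n0 LIMSEQ_ignore_initial_segment[OF sf(5), of n0]
    by (intro U_continuous U_closed) auto
  then have "(\<lambda>n. mdist X (U t (\<sigma> (n + n0)) (f (n + n0))) l) \<longlonglongrightarrow> 0"
    using assms sf n0 \<psi>(2) by (simp add: U_compose)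
  then show "l \<in> attractor t"
    using sf assms \<psi>(2) filterlim_compose[OF sf(1) filterlim_add_const_nat_at_top[of n0]]
    by (intro attractorI[of "\<lambda>n. \<sigma> (n + n0)" "\<lambda>n. f (n + n0)" K])
       (auto intro: U_closed)
next
  fix l assume "l \<in> attractor t"
  then obtain \<sigma> f K where sf: "filterlim \<sigma> at_bot sequentially" "\<And>n. f n \<in> mspace X"
      "\<And>n. size (f n) \<le> K" "l \<in> mspace X" "(\<lambda>n. mdist X (U t (\<sigma> n) (f n)) l) \<longlonglongrightarrow> 0"
    by (rule attractorE) (rule that)
  obtain k \<psi> where k: "strict_mono (k :: nat \<Rightarrow> nat)" "\<psi> \<in> attractor \<tau>"
      "(\<lambda>n. mdist X (U \<tau> (\<sigma> (k n)) (f (k n))) \<psi>) \<longlonglongrightarrow> 0"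
    by (rule asymptotic_subsequence[OF sf(1-3)])
  have psi: "\<psi> \<in> mspace X"
    using k(2) attractor_subset by blast
  have sk: "filterlim (\<lambda>n. \<sigma> (k n)) at_bot sequentially"
    by (rule filterlim_compose[OF sf(1) filterlim_subseq[OF k(1)]])
  then have "\<forall>\<^sub>F n in sequentially. \<sigma> (k n) \<le> \<tau>"
    by (simp add: filterlim_at_bot)
  then obtain n0 where n0: "\<And>n. n \<ge> n0 \<Longrightarrow> \<sigma> (k n) \<le> \<tau>"
    by (auto simp: eventually_sequentially)
  \<comment> \<open>Subsequence and shift are merged into one strictly increasing index map, along
    which the convergence to \<open>l\<close> is inherited.\<close>
  define j where "j n = k (n + n0)" for n
  have j: "\<sigma> (j n) \<le> \<tau>" for n
    using n0 by (simp add: j_def)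
  have "(\<lambda>n. mdist X (U t \<tau> (U \<tau> (\<sigma> (j n)) (f (j n)))) (U t \<tau> \<psi>)) \<longlonglongrightarrow> 0"
    using assms sf j psi LIMSEQ_ignore_initial_segment[OF k(3), of n0]
    by (intro U_continuous U_closed) (auto simp: j_def)
  then have 1: "(\<lambda>n. mdist X (U t (\<sigma> (j n)) (f (j n))) (U t \<tau> \<psi>)) \<longlonglongrightarrow> 0"
    using assms sf j by (simp add: U_compose)
  have "strict_mono j"
    using k(1) by (auto simp: j_def strict_mono_def)
  from LIMSEQ_subseq_LIMSEQ[OF sf(5) this]
  have 2: "(\<lambda>n. mdist X (U t (\<sigma> (j n)) (f (j n))) l) \<longlonglongrightarrow> 0"
    by (simp add: o_def)
  have "U t (\<sigma> (j n)) (f (j n)) \<in> mspace X" for n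
    using j[of n] assms sf by (intro U_closed) auto
  then have "l = U t \<tau> \<psi>"
    using mdist_limit_unique[OF 2 1] sf(4) U_closed[OF assms psi] by simp
  then show "l \<in> U t \<tau> ` attractor \<tau>"
    using k(2) by blast
qed

text \<open>By invariance the n-th point of a sequence in \<open>attractor t\<close> is the image of
  a point of \<open>attractor (t - real n)\<close>. These preimages have size at most
  \<open>R\<close> and their times tend to \<open>-\<infinity>\<close>, so asymptotic compactness
  yields a subsequence converging to a point of \<open>attractor t\<close>.\<close>

lemma attractor_compact: "compactin (mtopology_of X) (attractor t)"
proof -
  interpret Metric_space "mspace X" "mdist X"
    by simp
  have "\<exists>l k. l \<in> attractor t \<and> strict_mono k \<and> limitin mtopology (\<psi> \<circ> k) l sequentially"
    if \<psi>: "range \<psi> \<subseteq> attractor t" for \<psi> :: "nat \<Rightarrow> 'a"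
  proof -
    have "\<exists>\<eta>\<in>attractor (t - real n). \<psi> n = U t (t - real n) \<eta>" for n
    proof -
      have "\<psi> n \<in> U t (t - real n) ` attractor (t - real n)"
        using \<psi> attractor_invariant[of "t - real n" t] by auto
      then show ?thesis by blast
    qed
    then obtain \<eta> where \<eta>: "\<And>n. \<eta> n \<in> attractor (t - real n)"
        "\<And>n. \<psi> n = U t (t - real n) (\<eta> n)"
      by metis
    have *: "\<eta> n \<in> mspace X" "size (\<eta> n) \<le> R" for n
      using \<eta>(1)[of n] attractor_subset by auto
    have "filterlim (\<lambda>n. t - real n) at_bot sequentially"
      unfolding filterlim_at_bot
    proof (intro allI)
      fix Z
      obtain n0 where "t - Z \<le> real n0"
        using real_arch_simple by blast
      then show "\<forall>\<^sub>F n in sequentially. t - real n \<le> Z"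
        unfolding eventually_sequentially by (intro exI[of _ n0]) auto
    qed
    then obtain k l where k: "strict_mono (k :: nat \<Rightarrow> nat)" "l \<in> attractor t"
        "(\<lambda>n. mdist X (U t (t - real (k n)) (\<eta> (k n))) l) \<longlonglongrightarrow> 0"
      by (rule asymptotic_subsequence[OF _ *])
    have in_X: "\<psi> n \<in> mspace X" for n
      using \<psi> attractor_subset[of t] by auto
    have "limitin mtopology (\<psi> \<circ> k) l sequentially"
      unfolding limitin_metric_dist_null
      using k(2,3) \<eta>(2) attractor_subset[of t] in_X by (auto simp: o_def)
    with k show ?thesis by blast
  qed
  then show ?thesis
    using attractor_subset[of t] unfolding mtopology_of_def compactin_sequentially by blast
qed

text \<open>If attraction failed, points of \<open>B\<close> started at times
  \<open>\<sigma> n \<le> - real n\<close> would stay a fixed distance away from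
  \<open>attractor t\<close>, although a subsequence of their images converges to a point of
  it.\<close>

lemma attractor_attracts:
  assumes B: "B \<subseteq> mspace X" "\<And>\<phi>. \<phi> \<in> B \<Longrightarrow> size \<phi> \<le> K"
  shows "((\<lambda>\<tau>. hausdorff_semidist X (U t \<tau> ` B) (attractor t)) \<longlongrightarrow> 0) at_bot"
proof -
  have "\<forall>\<^sub>F \<tau> in at_bot. hausdorff_semidist X (U t \<tau> ` B) (attractor t) < a" if "a > 0" for a
  proof (rule ccontr)
    assume "\<not> ?thesis"
    then have "\<forall>n::nat. \<exists>\<tau>\<le>- real n. \<not> hausdorff_semidist X (U t \<tau> ` B) (attractor t) < a"
      by (simp add: eventually_at_bot_linorder)
    then obtain \<sigma> where \<sigma>: "\<And>n. \<sigma> n \<le> - real n"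
        "\<And>n. \<not> hausdorff_semidist X (U t (\<sigma> n) ` B) (attractor t) < a"
      by metis
    \<comment> \<open>The negated bound gives only \<open>a \<le>\<close> the semi-distance; a
      strictly smaller \<open>b\<close> is exceeded by the supremum and hence at some point of
      \<open>B\<close>.\<close>
    obtain b where b: "0 < b" "b < a"
      using \<open>a > 0\<close> dense by blast
    have "\<exists>\<phi>\<in>B. b < (INF \<psi>\<in>attractor t. ennreal (mdist X (U t (\<sigma> n) \<phi>) \<psi>))" for n
    proof -
      have "b < hausdorff_semidist X (U t (\<sigma> n) ` B) (attractor t)"
        using \<sigma>(2)[of n] b(2) by (metis leI less_le_trans)
      then show ?thesis
        unfolding hausdorff_semidist_def by (auto simp: less_SUP_iff)
    qed
    then obtain f where f: "\<And>n. f n \<in> B"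
        "\<And>n. b < (INF \<psi>\<in>attractor t. ennreal (mdist X (U t (\<sigma> n) (f n)) \<psi>))"
      by metis
    have "filterlim \<sigma> at_bot sequentially"
      unfolding filterlim_at_bot
    proof (intro allI)
      fix Z
      obtain n0 where "- Z \<le> real n0"
        using real_arch_simple by blast
      then have "\<sigma> n \<le> Z" if "n \<ge> n0" for n
        using \<sigma>(1)[of n] that by (smt (verit) of_nat_mono)
      then show "\<forall>\<^sub>F n in sequentially. \<sigma> n \<le> Z"
        unfolding eventually_sequentially by blast
    qed
    then obtain k l where k: "strict_mono (k :: nat \<Rightarrow> nat)" "l \<in> attractor t"
        "(\<lambda>n. mdist X (U t (\<sigma> (k n)) (f (k n))) l) \<longlonglongrightarrow> 0"
      using asymptotic_subsequence[of \<sigma> f K t] B f(1) by blast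
    have "(\<lambda>n. ennreal (mdist X (U t (\<sigma> (k n)) (f (k n))) l)) \<longlonglongrightarrow> ennreal 0"
      by (intro tendsto_ennrealI k(3))
    then have "\<forall>\<^sub>F n in sequentially. ennreal (mdist X (U t (\<sigma> (k n)) (f (k n))) l) < b"
      using b(1) by (intro order_tendstoD(2)) auto
    then obtain n where "ennreal (mdist X (U t (\<sigma> (k n)) (f (k n))) l) < b"
      by (auto simp: eventually_sequentially)
    moreover have "(INF \<psi>\<in>attractor t. ennreal (mdist X (U t (\<sigma> (k n)) (f (k n))) \<psi>))
        \<le> ennreal (mdist X (U t (\<sigma> (k n)) (f (k n))) l)"
      using k(2) by (rule INF_lower)
    ultimately show False
      using f(2)[of "k n"] by (meson leD less_le_trans less_trans)
  qed
  then show ?thesis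
    by (intro order_tendstoI) auto
qed

text \<open>Invariance places \<open>A' t\<close> inside the image of the \<open>R\<close>-ball from
  every earlier time. Attraction of that ball brings each point of \<open>A' t\<close> arbitrarily
  close to \<open>A t\<close>, which is closed because it is compact.\<close>

lemma subset_of_attracting:
  assumes comp: "compactin (mtopology_of X) (A t)"
    and sub: "\<And>s. A' s \<subseteq> {l \<in> mspace X. size l \<le> R}"
    and inv: "\<And>\<tau>. \<tau> \<le> t \<Longrightarrow> U t \<tau> ` A' \<tau> = A' t"
    and attr: "((\<lambda>\<tau>. hausdorff_semidist X (U t \<tau> ` {l \<in> mspace X. size l \<le> R}) (A t)) \<longlongrightarrow> 0) at_bot"
  shows "A' t \<subseteq> A t"
proof
  interpret Metric_space "mspace X" "mdist X"
    by simp
  fix \<psi> assume \<psi>: "\<psi> \<in> A' t"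
  then have \<psi>': "\<psi> \<in> mspace X"
    using sub by blast
  have near: "\<exists>\<eta>\<in>A t. mdist X \<psi> \<eta> < e" if "e > 0" for e
  proof -
    have "\<forall>\<^sub>F \<tau> in at_bot. hausdorff_semidist X (U t \<tau> ` {l \<in> mspace X. size l \<le> R}) (A t) < ennreal e"
      using order_tendstoD(2)[OF attr] that by simp
    then obtain \<tau> where \<tau>: "\<tau> \<le> t"
        "hausdorff_semidist X (U t \<tau> ` {l \<in> mspace X. size l \<le> R}) (A t) < ennreal e"
      unfolding eventually_at_bot_linorder by (metis min.cobounded1 min.cobounded2)
    have "\<psi> \<in> U t \<tau> ` {l \<in> mspace X. size l \<le> R}"
      using \<psi> inv[OF \<tau>(1)] sub by blast
    then have "(INF \<eta>\<in>A t. ennreal (mdist X \<psi> \<eta>)) < ennreal e"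
      using \<tau>(2) unfolding hausdorff_semidist_def by (meson SUP_upper le_less_trans)
    then show ?thesis
      by (auto simp: INF_less_iff ennreal_less_iff)
  qed
  have A: "A t \<subseteq> mspace X"
    using compactin_subset_topspace[OF comp] by (simp add: mtopology_of_def)
  have "closedin mtopology (A t)"
    using comp compactin_imp_closedin Hausdorff_space_mtopology by (auto simp: mtopology_of_def)
  moreover have "\<psi> \<in> mtopology closure_of (A t)"
    unfolding metric_closure_of using \<psi>' near A by (auto simp: subset_iff)
  ultimately show "\<psi> \<in> A t"
    by (simp add: closure_of_closedin)
qed

theorem pullback_attractor_unique_exists:
  "\<exists>!A. (\<forall>t. compactin (mtopology_of X) (A t) \<and> A t \<subseteq> {l \<in> mspace X. size l \<le> R}) \<and>
        (\<forall>\<tau> t. t \<ge> \<tau> \<longrightarrow> U t \<tau> ` A \<tau> = A t) \<and>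
        (\<forall>B. B \<subseteq> mspace X \<and> (\<exists>K. \<forall>\<phi>\<in>B. size \<phi> \<le> K) \<longrightarrow>
           (\<forall>t. ((\<lambda>\<tau>. hausdorff_semidist X (U t \<tau> ` B) (A t)) \<longlongrightarrow> 0) at_bot))"
  (is "\<exists>!A. ?attracting A")
proof (rule ex1I)
  show attractor: "?attracting attractor"
    using attractor_compact attractor_subset attractor_invariant attractor_attracts by blast
  fix A assume A: "?attracting A"
  \<comment> \<open>The states of size at most \<open>R\<close> form a bounded set, so any competing
    family attracts it; the two inclusions then follow with the roles exchanged.\<close>
  have attr: "((\<lambda>\<tau>. hausdorff_semidist X (U t \<tau> ` {l \<in> mspace X. size l \<le> R}) (A' t)) \<longlongrightarrow> 0) at_bot"
    if "?attracting A'" for A' t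
  proof -
    have "\<exists>K. \<forall>\<phi>\<in>{l \<in> mspace X. size l \<le> R}. size \<phi> \<le> K" "{l \<in> mspace X. size l \<le> R} \<subseteq> mspace X"
      by auto
    with that show ?thesis by simp
  qed
  have "A t = attractor t" for t
  proof
    have comp: "compactin (mtopology_of X) (A t)" and sub: "A s \<subseteq> {l \<in> mspace X. size l \<le> R}"
      and inv: "\<tau> \<le> t \<Longrightarrow> U t \<tau> ` A \<tau> = A t" for s \<tau>
      using A by auto
    show "A t \<subseteq> attractor t"
      by (rule subset_of_attracting[where A = attractor and A' = A, OF attractor_compact sub inv attr[OF attractor]])
    show "attractor t \<subseteq> A t"
      by (rule subset_of_attracting[where A = A and A' = attractor, OF comp attractor_subset attractor_invariant attr[OF A]])
  qed
  then show "A = attractor" by blast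
qed

end

section \<open>Delay equations with merely measurable delays\<close>

lemma dde_rhs_cong:
  assumes "\<And>i. 1 \<le> i \<Longrightarrow> i \<le> m \<Longrightarrow> \<delta> i s \<in> {0..r}" "\<And>u. s - r \<le> u \<Longrightarrow> u \<le> s \<Longrightarrow> x u = y u" "r \<ge> 0"
  shows "dde_rhs m F \<delta> x s = dde_rhs m F \<delta> y s"
proof -
  have "x (s - \<delta> i s) = y (s - \<delta> i s)" if "i \<in> {1..m}" for i
    using assms(1)[of i] that by (intro assms(2)) auto
  moreover have "x s = y s"
    using assms by auto
  ultimately show ?thesis
    unfolding dde_rhs_def by (intro arg_cong2[of _ _ _ _ "(+)"] sum.cong) auto
qed

section \<open>Integral solutions on bounded intervals\<close>

locale delay_equation =
  fixes r :: real and m :: nat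
    and F :: "nat \<Rightarrow> real \<Rightarrow> real ^ 'n \<Rightarrow> real ^ 'n" and \<delta> :: "nat \<Rightarrow> real \<Rightarrow> real"
  assumes r_nonneg: "r \<ge> 0"
    and F_continuous: "\<And>i. i \<le> m \<Longrightarrow> continuous_on UNIV (\<lambda>(t, x). F i t x)"
    and delay_measurable: "\<And>i. 1 \<le> i \<Longrightarrow> i \<le> m \<Longrightarrow> \<delta> i \<in> borel_measurable lebesgue"
    and delay_range: "\<And>i t. 1 \<le> i \<Longrightarrow> i \<le> m \<Longrightarrow> \<delta> i t \<in> {0..r}"
begin

abbreviation rhs :: "(real \<Rightarrow> real ^ 'n) \<Rightarrow> real \<Rightarrow> real ^ 'n" where
  "rhs \<equiv> dde_rhs m F \<delta>"

text \<open>A version of \<open>dde_solution\<close> on a bounded interval, with the gauge integral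
  and no prescribed history, so that solutions can be shortened and restarted freely. Integrability
  of \<open>rhs x\<close> comes from continuity of \<open>x\<close>, by
  \<open>rhs_absolutely_integrable\<close>.\<close>

definition solves :: "real \<Rightarrow> real \<Rightarrow> (real \<Rightarrow> real ^ 'n) \<Rightarrow> bool" where
  "solves \<tau> T x \<longleftrightarrow> continuous_on {\<tau> - r..T} x \<and>
     (\<forall>t\<in>{\<tau>..T}. x t = x \<tau> + integral {\<tau>..t} (rhs x))"

lemma solves_continuous: "solves \<tau> T x \<Longrightarrow> continuous_on {\<tau> - r..T} x"
  by (simp add: solves_def)

lemma solves_eq: "solves \<tau> T x \<Longrightarrow> \<tau> \<le> t \<Longrightarrow> t \<le> T \<Longrightarrow> x t = x \<tau> + integral {\<tau>..t} (rhs x)"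
  unfolding solves_def by (metis atLeastAtMost_iff)

lemma rhs_cong: "(\<And>u. s - r \<le> u \<Longrightarrow> u \<le> s \<Longrightarrow> x u = y u) \<Longrightarrow> rhs x s = rhs y s"
  using delay_range r_nonneg by (intro dde_rhs_cong) auto

lemma F_bounded_on_cball:
  obtains K where "K \<ge> 0" "\<And>i s v. i \<le> m \<Longrightarrow> s \<in> {a..b} \<Longrightarrow> norm v \<le> R \<Longrightarrow> norm (F i s v) \<le> K"
proof -
  have "\<exists>K. \<forall>i\<le>m. \<forall>s\<in>{a..b}. \<forall>v\<in>cball 0 R. norm (F i s v) \<le> K"
  proof -
    have "bounded (\<Union>i\<in>{..m}. (\<lambda>(t, x). F i t x) ` ({a..b} \<times> cball 0 R))"
    proof (intro bounded_UN finite_atMost ballI compact_imp_bounded compact_continuous_image)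
      fix i assume "i \<in> {..m}"
      then show "continuous_on ({a..b} \<times> cball 0 R) (\<lambda>(t, x). F i t x)"
        using F_continuous continuous_on_subset by blast
    qed (intro compact_Times compact_Icc compact_cball)
    then obtain K where "\<forall>y\<in>(\<Union>i\<in>{..m}. (\<lambda>(t, x). F i t x) ` ({a..b} \<times> cball 0 R)). norm y \<le> K"
      by (auto simp: bounded_iff)
    then show ?thesis
      by (intro exI[of _ K]) auto
  qed
  then obtain K where "\<forall>i\<le>m. \<forall>s\<in>{a..b}. \<forall>v\<in>cball 0 R. norm (F i s v) \<le> K"
    by blast
  then show thesis
    using that[of "max 0 K"] by (auto simp: le_max_iff_disj)
qed

text \<open>\<open>K\<close> is chosen before \<open>x\<close>: this uniformity later makes a whole
  family of solutions equi-Lipschitz.\<close>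

lemma rhs_bounded:
  obtains K where "K \<ge> 0"
    "\<And>x s. s \<in> {a..b} \<Longrightarrow> (\<And>u. u \<in> {s - r..s} \<Longrightarrow> norm (x u) \<le> R) \<Longrightarrow> norm (rhs x s) \<le> K"
proof -
  obtain K where K: "K \<ge> 0" "\<And>i s v. i \<le> m \<Longrightarrow> s \<in> {a..b} \<Longrightarrow> norm v \<le> R \<Longrightarrow> norm (F i s v) \<le> K"
    using F_bounded_on_cball by blast
  have "norm (rhs x s) \<le> K + (\<Sum>i = 1..m. K)"
    if "s \<in> {a..b}" "\<And>u. u \<in> {s - r..s} \<Longrightarrow> norm (x u) \<le> R" for x s
    unfolding dde_rhs_def using that delay_range r_nonneg
    by (intro norm_triangle_mono norm_sum[THEN order_trans] sum_mono K(2)) auto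
  then show thesis
    using K(1) by (intro that[of "K + (\<Sum>i = 1..m. K)"]) auto
qed

text \<open>A continuous function of a measurable argument is measurable: \<open>F i\<close> is
  jointly continuous and \<open>s - \<delta> i s\<close> is measurable in \<open>s\<close>.\<close>

lemma rhs_measurable:
  assumes "continuous_on {\<tau> - r..T} x"
  shows "rhs x \<in> borel_measurable (lebesgue_on {\<tau>..T})"
proof -
  \<comment> \<open>\<open>x\<close> is controlled only on \<open>[\<tau> - r, T]\<close>. Freezing
    it at the end points gives a continuous function on the whole line with the same delayed values
    at times in \<open>[\<tau>, T]\<close>.\<close>
  define y where "y u = x (max (\<tau> - r) (min T u))" for u
  show ?thesis
  proof (cases "\<tau> \<le> T")
    case True
    have y: "continuous_on UNIV y"
      unfolding y_def using True r_nonneg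
      by (intro continuous_on_compose2[OF assms] continuous_intros) auto
    have "(\<lambda>s. (case (s, y (s - d s)) of (t, v) \<Rightarrow> F i t v)) \<in> borel_measurable lebesgue"
      if "i \<le> m" "d \<in> borel_measurable lebesgue" for i d
    proof (rule borel_measurable_continuous_on[OF F_continuous[OF that(1)]])
      have [measurable]: "(\<lambda>s. s) \<in> borel_measurable (lebesgue :: real measure)"
        by (simp add: measurable_completion)
      have "(\<lambda>s. y (s - d s)) \<in> borel_measurable lebesgue"
        using that(2) by (intro borel_measurable_continuous_on[OF y] borel_measurable_diff) simp_all
      then show "(\<lambda>s. (s, y (s - d s))) \<in> borel_measurable lebesgue"
        by (intro borel_measurable_Pair) auto
    qed
    \<comment> \<open>The zero delay covers the term with \<open>F 0\<close>, the second instance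
      the delayed terms.\<close>
    from this[of _ "\<lambda>_. 0"] this[of _ "\<delta> _"]
    have "rhs y \<in> borel_measurable lebesgue"
      unfolding dde_rhs_def using delay_measurable
      by (intro borel_measurable_add borel_measurable_sum) auto
    then have "rhs y \<in> borel_measurable (lebesgue_on {\<tau>..T})"
      by (rule measurable_restrict_space1)
    moreover have "rhs x s = rhs y s" if "s \<in> {\<tau>..T}" for s
      using that by (intro rhs_cong) (auto simp: y_def)
    ultimately show ?thesis
      by (subst measurable_cong[where g = "rhs y"]) auto
  qed (auto simp: measurable_def space_restrict_space)
qed

lemma rhs_absolutely_integrable:
  assumes "continuous_on {\<tau> - r..T} x"
  shows "rhs x absolutely_integrable_on {\<tau>..T}"
proof -
  obtain R where R: "\<And>u. u \<in> {\<tau> - r..T} \<Longrightarrow> norm (x u) \<le> R"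
    using compact_imp_bounded[OF compact_continuous_image[OF assms compact_Icc]]
    by (metis bounded_iff image_eqI)
  obtain K where K: "\<And>x s. s \<in> {\<tau>..T} \<Longrightarrow> (\<And>u. u \<in> {s - r..s} \<Longrightarrow> norm (x u) \<le> R) \<Longrightarrow> norm (rhs x s) \<le> K"
    using rhs_bounded[of \<tau> T R] by blast
  show ?thesis
    by (rule measurable_bounded_by_integrable_imp_absolutely_integrable[OF rhs_measurable[OF assms], of "\<lambda>_. K"])
       (use K R in auto)
qed

lemma rhs_integrable:
  assumes "continuous_on {\<tau> - r..T} x" "\<tau> \<le> a" "b \<le> T"
  shows "rhs x integrable_on {a..b}"
proof -
  have "rhs x integrable_on {\<tau>..T}"
    using rhs_absolutely_integrable[OF assms(1)] by (rule set_lebesgue_integral_eq_integral(1))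
  then show ?thesis
    by (rule integrable_on_subinterval) (use assms in auto)
qed

lemma solves_subinterval: "solves \<tau> T x \<Longrightarrow> T' \<le> T \<Longrightarrow> solves \<tau> T' x"
  unfolding solves_def by (meson atLeastatMost_subset_iff atLeastAtMost_iff continuous_on_subset order_refl order_trans)

lemma solves_increment:
  assumes "solves \<tau> T x" "\<tau> \<le> a" "a \<le> b" "b \<le> T"
  shows "x b - x a = integral {a..b} (rhs x)"
proof -
  have "rhs x integrable_on {\<tau>..b}"
    using assms by (intro rhs_integrable[of \<tau> T]) (auto simp: solves_def)
  from Henstock_Kurzweil_Integration.integral_combine[OF assms(2,3) this]
  have "integral {\<tau>..b} (rhs x) = integral {\<tau>..a} (rhs x) + integral {a..b} (rhs x)"
    by simp
  moreover have "x a = x \<tau> + integral {\<tau>..a} (rhs x)" "x b = x \<tau> + integral {\<tau>..b} (rhs x)"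
    using assms by (auto intro!: solves_eq)
  ultimately show ?thesis
    by (metis add_diff_cancel_left add_diff_cancel_left')
qed

lemma solves_restart:
  assumes "solves \<tau> T x" "\<tau> \<le> \<sigma>"
  shows "solves \<sigma> T x"
  unfolding solves_def
proof (intro conjI ballI)
  show "continuous_on {\<sigma> - r..T} x"
    using assms by (auto simp: solves_def elim: continuous_on_subset)
  fix t assume "t \<in> {\<sigma>..T}"
  then show "x t = x \<sigma> + integral {\<sigma>..t} (rhs x)"
    using solves_increment[OF assms(1), of \<sigma> t] assms by (simp add: algebra_simps)
qed

lemma solves_cong:
  assumes "solves \<tau> T x" "\<And>u. u \<in> {\<tau> - r..T} \<Longrightarrow> x u = y u"
  shows "solves \<tau> T y"
  unfolding solves_def
proof (intro conjI ballI)
  show "continuous_on {\<tau> - r..T} y"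
    using assms by (metis solves_def continuous_on_eq)
  fix t assume t: "t \<in> {\<tau>..T}"
  have "integral {\<tau>..t} (rhs x) = integral {\<tau>..t} (rhs y)"
    using t assms(2) by (intro integral_cong rhs_cong) auto
  then show "y t = y \<tau> + integral {\<tau>..t} (rhs y)"
    using solves_eq[OF assms(1), of t] t assms(2)[of t] assms(2)[of \<tau>] r_nonneg by simp
qed

text \<open>On each bounded interval \<open>rhs x\<close> is absolutely integrable, so Lebesgue and
  gauge integral agree. Continuity on the half-line is a local property and is glued from bounded
  intervals.\<close>

lemma dde_solution_iff_solves:
  "dde_solution r m F \<delta> \<tau> \<phi> x \<longleftrightarrow> (\<forall>s\<in>{-r..0}. x (\<tau> + s) = \<phi> s) \<and> (\<forall>T\<ge>\<tau>. solves \<tau> T x)"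
  (is "?l \<longleftrightarrow> ?r")
proof
  assume l: ?l
  then have "x (\<tau> + 0) = \<phi> 0"
    unfolding dde_solution_def using r_nonneg by (metis atLeastAtMost_iff neg_le_0_iff_le order_refl)
  moreover have "(LINT s:{\<tau>..t}|lebesgue. rhs x s) = integral {\<tau>..t} (rhs x)" if "t \<ge> \<tau>" for t
    using l that unfolding dde_solution_def by (intro set_lebesgue_integral_eq_integral) auto
  moreover have "continuous_on {\<tau> - r..T} x" for T
    using l unfolding dde_solution_def by (auto elim: continuous_on_subset)
  ultimately show ?r
    using l unfolding dde_solution_def solves_def by auto
next
  assume ?r
  then have init: "\<forall>s\<in>{-r..0}. x (\<tau> + s) = \<phi> s" and sol: "\<And>T. T \<ge> \<tau> \<Longrightarrow> solves \<tau> T x"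
    by auto
  have "x (\<tau> + 0) = \<phi> 0"
    using init r_nonneg by (metis atLeastAtMost_iff neg_le_0_iff_le order_refl)
  have "continuous_on {\<tau> - r..} x"
    unfolding continuous_on_eq_continuous_within
  proof
    fix t assume t: "t \<in> {\<tau> - r..}"
    have "continuous_on {\<tau> - r..max \<tau> t + 1} x"
      using sol[of "max \<tau> t + 1"] by (simp add: solves_def)
    then have "continuous (at t within {\<tau> - r..max \<tau> t + 1}) x"
      using t by (auto simp: continuous_on_eq_continuous_within)
    moreover have "at t within {\<tau> - r..max \<tau> t + 1} = at t within {\<tau> - r..}"
      by (rule at_within_nhd[of _ "{..<max \<tau> t + 1}"]) auto
    ultimately show "continuous (at t within {\<tau> - r..}) x"
      by simp
  qed
  moreover have "set_integrable lebesgue {\<tau>..t} (rhs x)" if "t \<ge> \<tau>" for t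
    using sol[OF that] by (intro rhs_absolutely_integrable) (auto simp: solves_def)
  moreover from this have "(LINT s:{\<tau>..t}|lebesgue. rhs x s) = integral {\<tau>..t} (rhs x)" if "t \<ge> \<tau>" for t
    using that by (intro set_lebesgue_integral_eq_integral) auto
  ultimately show ?l
    using init sol \<open>x (\<tau> + 0) = \<phi> 0\<close> unfolding dde_solution_def solves_def by auto
qed

text \<open>The exponential weight makes the integral operator a contraction on intervals of any
  length once \<open>\<kappa>\<close> exceeds \<open>L (m + 1)\<close>; it is constant before \<open>\<tau>\<close> so that delayed arguments
  carry at most the weight of the present time.\<close>

lemma integral_rhs_difference:
  assumes x: "continuous_on {\<tau> - r..T} x" and y: "continuous_on {\<tau> - r..T} y"
    and "L \<ge> 0" "\<kappa> > 0"
    and lip: "\<And>i s u. i \<le> m \<Longrightarrow> s \<in> {\<tau>..T} \<Longrightarrow> u \<in> {\<tau> - r..T} \<Longrightarrow>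
      norm (F i s (x u) - F i s (y u)) \<le> L * norm (x u - y u)"
    and close: "\<And>u. u \<in> {\<tau> - r..T} \<Longrightarrow> norm (x u - y u) \<le> D * exp (\<kappa> * max 0 (u - \<tau>))"
    and t: "t \<in> {\<tau>..T}"
  shows "norm (integral {\<tau>..t} (rhs x) - integral {\<tau>..t} (rhs y))
    \<le> L * real (m + 1) / \<kappa> * D * exp (\<kappa> * (t - \<tau>))"
proof -
  \<comment> \<open>At \<open>\<tau>\<close> the weight is 1, so \<open>D\<close> bounds a
    norm.\<close>
  have "norm (x \<tau> - y \<tau>) \<le> D"
    using close[of \<tau>] t r_nonneg by auto
  then have D: "D \<ge> 0"
    by (rule order_trans[OF norm_ge_zero])
  define E where "E s = exp (\<kappa> * (s - \<tau>))" for s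
  have "norm (rhs x s - rhs y s) \<le> L * real (m + 1) * D * E s" if s: "s \<in> {\<tau>..t}" for s
  proof -
    have F: "norm (F i s (x u) - F i s (y u)) \<le> L * D * E s" if "i \<le> m" "u \<in> {s - r..s}" for i u
    proof -
      have "norm (F i s (x u) - F i s (y u)) \<le> L * norm (x u - y u)"
        using that s t by (intro lip) auto
      also have "\<dots> \<le> L * (D * exp (\<kappa> * max 0 (u - \<tau>)))"
        using that s t \<open>L \<ge> 0\<close> by (intro mult_left_mono close) auto
      also have "\<dots> \<le> L * (D * E s)"
        unfolding E_def using that s D \<open>L \<ge> 0\<close> \<open>\<kappa> > 0\<close> by (intro mult_left_mono) auto
      finally show ?thesis
        by (simp add: mult.assoc)
    qed
    have "rhs x s - rhs y s = (F 0 s (x s) - F 0 s (y s)) +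
        (\<Sum>i = 1..m. F i s (x (s - \<delta> i s)) - F i s (y (s - \<delta> i s)))"
      by (simp add: dde_rhs_def sum_subtractf)
    also have "norm \<dots> \<le> L * D * E s + (\<Sum>i = 1..m. L * D * E s)"
      using delay_range r_nonneg
      by (intro norm_triangle_mono norm_sum[THEN order_trans] sum_mono F) auto
    also have "\<dots> = L * real (m + 1) * D * E s"
      by (simp add: algebra_simps)
    finally show ?thesis .
  qed
  moreover have "((\<lambda>s. E s) has_integral (E t / \<kappa> - E \<tau> / \<kappa>)) {\<tau>..t}"
  proof (rule fundamental_theorem_of_calculus)
    show "((\<lambda>s. E s / \<kappa>) has_vector_derivative E s) (at s within {\<tau>..t})" for s
      unfolding E_def has_real_derivative_iff_has_vector_derivative[symmetric]
      using \<open>\<kappa> > 0\<close> by (auto intro!: derivative_eq_intros)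
  qed (use t in auto)
  then have E: "((\<lambda>s. L * real (m + 1) * D * E s) has_integral
      L * real (m + 1) * D * (E t / \<kappa> - E \<tau> / \<kappa>)) {\<tau>..t}"
    by (rule has_integral_mult_right)
  moreover have int: "rhs x integrable_on {\<tau>..t}" "rhs y integrable_on {\<tau>..t}"
    using rhs_integrable[OF x] rhs_integrable[OF y] t by auto
  ultimately have "norm (integral {\<tau>..t} (\<lambda>s. rhs x s - rhs y s))
      \<le> integral {\<tau>..t} (\<lambda>s. L * real (m + 1) * D * E s)"
    by (intro integral_norm_bound_integral integrable_diff) (auto simp: has_integral_integrable)
  also have "\<dots> = L * real (m + 1) * D * (E t / \<kappa> - E \<tau> / \<kappa>)"
    using E by (rule integral_unique)
  also have "\<dots> \<le> L * real (m + 1) * D * (E t / \<kappa>)"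
    using D \<open>L \<ge> 0\<close> \<open>\<kappa> > 0\<close> by (intro mult_left_mono) (auto simp: E_def)
  finally show ?thesis
    using int by (simp add: integral_diff E_def mult.commute mult.left_commute)
qed

text \<open>A substitute for Gronwall's inequality. The weighted difference \<open>g\<close> attains
  its maximum at some \<open>v\<close>; if \<open>v > \<tau>\<close>, the integral equation and the
  contraction estimate give \<open>g v \<le> d + g v / 2\<close>, hence
  \<open>g v \<le> 2 * d\<close>.\<close>

lemma solves_stable:
  assumes x: "solves \<tau> T x" and y: "solves \<tau> T y" and "\<tau> \<le> T" "L \<ge> 0"
    and lip: "\<And>i s u. i \<le> m \<Longrightarrow> s \<in> {\<tau>..T} \<Longrightarrow> u \<in> {\<tau> - r..T} \<Longrightarrow>
      norm (F i s (x u) - F i s (y u)) \<le> L * norm (x u - y u)"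
    and init: "\<And>u. u \<in> {\<tau> - r..\<tau>} \<Longrightarrow> norm (x u - y u) \<le> d"
    and t: "t \<in> {\<tau> - r..T}"
  shows "norm (x t - y t) \<le> 2 * d * exp ((2 * L * real (m + 1) + 1) * (T - \<tau>))"
proof -
  \<comment> \<open>This makes the contraction factor \<open>L * real (m + 1) / \<kappa>\<close> at
    most 1/2; the summand 1 keeps \<open>\<kappa>\<close> positive when
    \<open>L = 0\<close>.\<close>
  define \<kappa> where "\<kappa> = 2 * L * real (m + 1) + 1"
  define w where "w u = exp (\<kappa> * max 0 (u - \<tau>))" for u
  define g where "g u = norm (x u - y u) / w u" for u
  have \<kappa>: "\<kappa> > 0"
    using \<open>L \<ge> 0\<close> by (simp add: \<kappa>_def add_nonneg_pos)
  have w: "w u \<ge> 1" "w u > 0" for u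
    using \<kappa> by (simp_all add: w_def)
  have cont: "continuous_on {\<tau> - r..T} x" "continuous_on {\<tau> - r..T} y"
    using x y by (auto intro: solves_continuous)
  have "continuous_on {\<tau> - r..T} g"
    unfolding g_def w_def by (intro continuous_intros cont) auto
  moreover have "compact {\<tau> - r..T}" "{\<tau> - r..T} \<noteq> {}"
    using \<open>\<tau> \<le> T\<close> r_nonneg by auto
  ultimately obtain v where v: "v \<in> {\<tau> - r..T}" "\<And>u. u \<in> {\<tau> - r..T} \<Longrightarrow> g u \<le> g v"
    using continuous_attains_sup[of "{\<tau> - r..T}" g] by blast
  have close: "norm (x u - y u) \<le> g v * w u" if "u \<in> {\<tau> - r..T}" for u
    using v(2)[OF that] w[of u] by (simp add: g_def[of u] divide_le_eq)
  have d: "d \<ge> 0"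
    using order_trans[OF norm_ge_zero init[of \<tau>]] r_nonneg by simp
  have "g v \<ge> 0"
    by (simp add: g_def w_def)
  have "g v \<le> 2 * d"
  proof (cases "v \<le> \<tau>")
    case True
    then have "norm (x v - y v) \<le> d" "w v = 1"
      using init[of v] v(1) by (auto simp: w_def)
    then show ?thesis
      using d by (simp add: g_def)
  next
    case False
    then have v': "v \<in> {\<tau>..T}"
      using v(1) by auto
    have "x v - y v = (x \<tau> - y \<tau>) + (integral {\<tau>..v} (rhs x) - integral {\<tau>..v} (rhs y))"
      using solves_eq[OF x, of v] solves_eq[OF y, of v] v' by (simp add: algebra_simps)
    also have "norm \<dots> \<le> d + L * real (m + 1) / \<kappa> * g v * exp (\<kappa> * (v - \<tau>))"
      using init[of \<tau>] r_nonneg v' \<kappa> \<open>L \<ge> 0\<close> cont close lip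
      by (intro norm_triangle_mono integral_rhs_difference[of \<tau> T]) (auto simp: w_def)
    also have "exp (\<kappa> * (v - \<tau>)) = w v"
      using False by (simp add: w_def)
    also have "L * real (m + 1) / \<kappa> * g v * w v \<le> 1 / 2 * g v * w v"
    proof (intro mult_right_mono)
      show "L * real (m + 1) / \<kappa> \<le> 1 / 2"
        using \<kappa> by (simp add: divide_le_eq) (simp add: \<kappa>_def)
    qed (use \<open>g v \<ge> 0\<close> w[of v] in auto)
    \<comment> \<open>As \<open>w v \<ge> 1\<close>, also \<open>d\<close> may carry the weight, so
      that division by \<open>w v\<close> leaves \<open>d + g v / 2\<close>.\<close>
    finally have "norm (x v - y v) \<le> d * w v + 1 / 2 * g v * w v"
      using mult_left_mono[of 1 "w v" d] w[of v] d by simp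
    then have "g v \<le> (d * w v + 1 / 2 * g v * w v) / w v"
      unfolding g_def[of v] using w[of v] by (intro divide_right_mono) auto
    also have "\<dots> = d + 1 / 2 * g v"
      using w[of v] by (simp add: add_divide_distrib)
    finally show ?thesis by simp
  qed
  have "norm (x t - y t) \<le> g v * w t"
    using t by (rule close)
  also have "\<dots> \<le> 2 * d * exp (\<kappa> * (T - \<tau>))"
    using \<open>g v \<le> 2 * d\<close> \<open>g v \<ge> 0\<close> d t \<kappa> \<open>\<tau> \<le> T\<close> unfolding w_def by (intro mult_mono) auto
  finally show ?thesis
    by (simp add: \<kappa>_def)
qed

text \<open>Banach's fixed point theorem in the bounded continuous functions on the line. The
  unknown \<open>y\<close> is the increment of the solution since \<open>\<tau>\<close> times
  \<open>exp (- \<kappa> * (t - \<tau>))\<close>, so that the plain sup distance acts as the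
  weighted one.\<close>

lemma solves_exists_global_Lipschitz:
  assumes \<phi>: "continuous_on {-r..0} \<phi>" and "\<tau> \<le> T" "L \<ge> 0"
    and lip: "\<And>i s a b. i \<le> m \<Longrightarrow> s \<in> {\<tau>..T} \<Longrightarrow> norm (F i s a - F i s b) \<le> L * norm (a - b)"
  shows "\<exists>x. solves \<tau> T x \<and> (\<forall>s\<in>{-r..0}. x (\<tau> + s) = \<phi> s)"
proof -
  \<comment> \<open>The values at \<open>\<tau>\<close> of two unknowns also enter \<open>X\<close>
    and double the distance, hence the 4 for a contraction factor 1/2.\<close>
  define \<kappa> where "\<kappa> = 4 * L * real (m + 1) + 1"
  have \<kappa>: "\<kappa> > 0"
    using \<open>L \<ge> 0\<close> by (simp add: \<kappa>_def add_nonneg_pos)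
  define cl where "cl t = max \<tau> (min T t)" for t
  \<comment> \<open>\<open>X y\<close> rebuilds the trajectory: \<open>\<phi>\<close> before
    \<open>\<tau>\<close>, then \<open>\<phi> 0\<close> plus the unweighted increment. Subtracting
    \<open>y \<tau>\<close> makes \<open>X y\<close> match the history for every \<open>y\<close>,
    not only for the fixed point; clamping by \<open>cl\<close> keeps \<open>P y\<close> bounded on
    the whole line.\<close>
  define X where "X y t = \<phi> (max (-r) (min 0 (t - \<tau>))) + exp (\<kappa> * (cl t - \<tau>)) *\<^sub>R (y (cl t) - y \<tau>)"
    for y :: "real \<Rightarrow>\<^sub>C (real ^ 'n)" and t
  define P where "P y t = exp (- \<kappa> * (cl t - \<tau>)) *\<^sub>R integral {\<tau>..cl t} (rhs (X y))" for y t
  have cl: "cl t \<in> {\<tau>..T}" for t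
    using \<open>\<tau> \<le> T\<close> by (auto simp: cl_def)
  have cont_cl: "continuous_on A cl" for A
    unfolding cl_def by (intro continuous_intros)
  have cont_X: "continuous_on A (X y)" for A y
    unfolding X_def using r_nonneg
    by (intro continuous_intros continuous_on_compose2[OF \<phi>] cont_cl
        continuous_on_compose2[OF continuous_on_apply_bcontfun[of UNIV]]) auto
  have P: "P y \<in> bcontfun" for y
  proof -
    have "continuous_on {\<tau>..T} (\<lambda>t. integral {\<tau>..t} (rhs (X y)))"
      by (intro indefinite_integral_continuous_1 rhs_integrable[OF cont_X, of \<tau> _ T]) auto
    then have *: "continuous_on {\<tau>..T} (\<lambda>t. exp (- \<kappa> * (t - \<tau>)) *\<^sub>R integral {\<tau>..t} (rhs (X y)))"
      by (intro continuous_intros)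
    have "continuous_on UNIV (P y)"
      unfolding P_def by (rule continuous_on_compose2[OF * cont_cl]) (use cl in auto)
    moreover have "bounded (range (P y))"
      by (rule bounded_subset[OF compact_imp_bounded[OF compact_continuous_image[OF * compact_Icc]]])
         (use cl in \<open>auto simp: P_def\<close>)
    ultimately show ?thesis
      by (simp add: bcontfun_def)
  qed
  have "\<exists>!y. Bcontfun (P y) = y"
  proof (rule banach_fix_type[of "1/2"]; (intro allI)?)
    fix y z :: "real \<Rightarrow>\<^sub>C (real ^ 'n)"
    have close: "norm (X y u - X z u) \<le> 2 * dist y z * exp (\<kappa> * max 0 (u - \<tau>))"
      if "u \<in> {\<tau> - r..T}" for u
    proof -
      have "X y u - X z u = exp (\<kappa> * (cl u - \<tau>)) *\<^sub>R ((y (cl u) - z (cl u)) - (y \<tau> - z \<tau>))"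
        by (simp add: X_def algebra_simps)
      also have "norm \<dots> = exp (\<kappa> * (cl u - \<tau>)) * norm ((y (cl u) - z (cl u)) - (y \<tau> - z \<tau>))"
        by simp
      also have "\<dots> \<le> exp (\<kappa> * (cl u - \<tau>)) * (dist y z + dist y z)"
        using dist_bounded[of y _ z]
        by (intro mult_left_mono order_trans[OF norm_triangle_ineq4 add_mono]) (auto simp flip: dist_norm)
      also have "cl u - \<tau> = max 0 (u - \<tau>)"
        using that by (auto simp: cl_def)
      finally show ?thesis
        by (simp add: mult.commute)
    qed
    have "dist (P y t) (P z t) \<le> 1 / 2 * dist y z" for t
    proof -
      have "dist (P y t) (P z t) = exp (- \<kappa> * (cl t - \<tau>)) *
          norm (integral {\<tau>..cl t} (rhs (X y)) - integral {\<tau>..cl t} (rhs (X z)))"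
        by (simp add: P_def dist_norm flip: scaleR_diff_right)
      also have "\<dots> \<le> exp (- \<kappa> * (cl t - \<tau>)) *
          (L * real (m + 1) / \<kappa> * (2 * dist y z) * exp (\<kappa> * (cl t - \<tau>)))"
        using cl \<open>L \<ge> 0\<close> \<kappa> lip close cont_X
        by (intro mult_left_mono integral_rhs_difference[of \<tau> T]) auto
      also have "\<dots> = 2 * (L * real (m + 1) / \<kappa>) * dist y z"
        by (simp flip: exp_add)
      also have "\<dots> \<le> 1 / 2 * dist y z"
      proof (intro mult_right_mono)
        show "2 * (L * real (m + 1) / \<kappa>) \<le> 1 / 2"
          using \<kappa> by (simp add: divide_le_eq) (simp add: \<kappa>_def)
      qed auto
      finally show ?thesis .
    qed
    then show "dist (Bcontfun (P y)) (Bcontfun (P z)) \<le> 1 / 2 * dist y z"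
      by (intro dist_bound) (simp add: Bcontfun_inverse P)
  qed auto
  then obtain y where "Bcontfun (P y) = y"
    by blast
  then have fix_y: "apply_bcontfun y t = P y t" for t
    by (metis Bcontfun_inverse P)
  have cl_id: "cl t = t" if "t \<in> {\<tau>..T}" for t
    using that by (auto simp: cl_def)
  \<comment> \<open>The integral in \<open>P y \<tau>\<close> is over a single point, so the
    correction by \<open>y \<tau>\<close> vanishes at the fixed point.\<close>
  have "y \<tau> = 0"
    using \<open>\<tau> \<le> T\<close> by (simp add: fix_y P_def cl_id)
  have X_eq: "X y t = \<phi> 0 + integral {\<tau>..t} (rhs (X y))" if "t \<in> {\<tau>..T}" for t
  proof -
    have "max (- r) (min 0 (t - \<tau>)) = 0"
      using that r_nonneg by auto
    then have "X y t = \<phi> 0 + exp (\<kappa> * (t - \<tau>)) *\<^sub>R P y t"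
      using that fix_y[of t] \<open>y \<tau> = 0\<close> by (simp add: X_def cl_id)
    then show ?thesis
      using that by (simp add: P_def cl_id flip: exp_add)
  qed
  have "solves \<tau> T (X y)"
    using cont_X X_eq X_eq[of \<tau>] \<open>\<tau> \<le> T\<close> by (simp add: solves_def)
  moreover have "X y (\<tau> + s) = \<phi> s" if "s \<in> {-r..0}" for s
  proof -
    have "cl (\<tau> + s) = \<tau>" "max (- r) (min 0 (\<tau> + s - \<tau>)) = s"
      using that \<open>\<tau> \<le> T\<close> by (auto simp: cl_def)
    then show ?thesis
      by (simp add: X_def)
  qed
  ultimately show ?thesis by blast
qed

end

section \<open>A priori bound and global solutions\<close>

text \<open>Stands in for the chain rule for the norm of an absolutely continuous curve. Over a short
  interval \<open>[s, t]\<close> the unit vector \<open>sgn (x t)\<close> satisfies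
  \<open>\<bar>x t\<bar> - \<bar>x s\<bar> \<le> sgn (x t) \<bullet> (x t - x s)\<close>, and replacing it by \<open>sgn (x v)\<close> under the integral
  costs at most \<open>e\<close> times the integral of \<open>\<bar>f\<bar>\<close>.\<close>

lemma norm_increment_le_integral:
  fixes x f :: "real \<Rightarrow> 'a :: euclidean_space" and g :: "real \<Rightarrow> real"
  assumes "a \<le> b"
    and f: "f absolutely_integrable_on {a..b}"
    and x: "\<And>s t. a \<le> s \<Longrightarrow> s \<le> t \<Longrightarrow> t \<le> b \<Longrightarrow> x t - x s = integral {s..t} f"
    and cont: "continuous_on {a..b} x" and nz: "\<And>t. t \<in> {a..b} \<Longrightarrow> x t \<noteq> 0"
    and g: "g integrable_on {a..b}"
    and le: "\<And>t. t \<in> {a..b} \<Longrightarrow> x t \<bullet> f t \<le> norm (x t) * g t"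
  shows "norm (x b) - norm (x a) \<le> integral {a..b} g"
proof -
  have f': "f integrable_on {a..b}" "(\<lambda>t. norm (f t)) integrable_on {a..b}"
    using f by (auto simp: absolutely_integrable_on_def)
  have sub: "h integrable_on {s..t}" if "h integrable_on {a..b}" "a \<le> s" "t \<le> b"
    for s t and h :: "real \<Rightarrow> 'b :: euclidean_space"
    by (rule integrable_on_subinterval[OF that(1)]) (use that in auto)
  define u where "u t = sgn (x t)" for t
  have cont_u: "continuous_on {a..b} u"
    unfolding u_def sgn_div_norm by (intro continuous_intros cont) (use nz in auto)
  have norm_u: "norm (u t) = 1" if "t \<in> {a..b}" for t
    using nz[OF that] by (simp add: u_def norm_sgn)
  have approx: "norm (x b) - norm (x a) \<le> integral {a..b} (\<lambda>v. g v + e * norm (f v))" if "e > 0" for e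
  proof -
    define h where "h v = g v + e * norm (f v)" for v
    have h: "h integrable_on {a..b}"
      unfolding h_def by (intro integrable_add integrable_on_mult_right g f')
    have "a \<le> a \<and> a \<le> b \<and> b \<le> b \<longrightarrow> norm (x b) - norm (x a) \<le> integral {a..b} h"
    \<comment> \<open>Bisection: the inequality adds up over adjacent intervals, so it suffices to
      prove it on all short intervals around each point.\<close>
    proof (rule Bolzano[of a b "\<lambda>s t. a \<le> s \<and> s \<le> t \<and> t \<le> b \<longrightarrow> norm (x t) - norm (x s) \<le> integral {s..t} h"])
      fix s c t
      assume 1: "a \<le> s \<and> s \<le> c \<and> c \<le> b \<longrightarrow> norm (x c) - norm (x s) \<le> integral {s..c} h"
        and 2: "a \<le> c \<and> c \<le> t \<and> t \<le> b \<longrightarrow> norm (x t) - norm (x c) \<le> integral {c..t} h"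
        and 3: "s \<le> c" "c \<le> t"
      show "a \<le> s \<and> s \<le> t \<and> t \<le> b \<longrightarrow> norm (x t) - norm (x s) \<le> integral {s..t} h"
      proof
        assume 4: "a \<le> s \<and> s \<le> t \<and> t \<le> b"
        have "h integrable_on {s..t}"
          using 4 sub[OF h] by simp
        from Henstock_Kurzweil_Integration.integral_combine[OF 3 this]
        show "norm (x t) - norm (x s) \<le> integral {s..t} h"
          using 1 2 3 4 by linarith
      qed
    next
      fix y assume y: "a \<le> y" "y \<le> b"
      then obtain d where d: "d > 0" "\<And>v. v \<in> {a..b} \<Longrightarrow> dist v y < d \<Longrightarrow> dist (u v) (u y) < e / 2"
        using cont_u \<open>e > 0\<close> unfolding continuous_on_iff by (metis atLeastAtMost_iff half_gt_zero)
      have "norm (x t) - norm (x s) \<le> integral {s..t} h"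
        if *: "s \<le> y" "y \<le> t" "t - s < d" "a \<le> s" "s \<le> t" "t \<le> b" for s t
      proof -
        have fs: "f integrable_on {s..t}"
          using * sub[OF f'(1)] by simp
        have int: "((\<lambda>v. u t \<bullet> f v) has_integral (u t \<bullet> integral {s..t} f)) {s..t}"
          using has_integral_linear[OF integrable_integral[OF fs] bounded_linear_inner_right[of "u t"]]
          by (simp add: o_def)
        have "u t \<bullet> x t = norm (x t)"
          using nz[of t] * by (simp add: u_def sgn_div_norm power2_norm_eq_inner[symmetric] power2_eq_square)
        moreover have "u t \<bullet> x s \<le> norm (x s)"
          using norm_cauchy_schwarz[of "u t" "x s"] norm_u[of t] * by simp
        ultimately have "norm (x t) - norm (x s) \<le> u t \<bullet> (x t - x s)"
          by (simp add: inner_diff_right)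
        also have "\<dots> = u t \<bullet> integral {s..t} f"
          using x * by simp
        also have "\<dots> \<le> integral {s..t} h"
        proof (rule has_integral_le[OF int integrable_integral])
          show "h integrable_on {s..t}"
            using * sub[OF h] by simp
          fix v assume v: "v \<in> {s..t}"
          have "dist (u t) (u v) \<le> dist (u t) (u y) + dist (u v) (u y)"
            by (rule dist_triangle2)
          also have "\<dots> \<le> e"
            using d(2)[of t] d(2)[of v] v * by (force simp: dist_real_def)
          finally have "(u t - u v) \<bullet> f v \<le> e * norm (f v)"
            using norm_cauchy_schwarz[of "u t - u v" "f v"]
            by (smt (verit) dist_norm mult_right_mono norm_ge_zero)
          moreover have "u v \<bullet> f v \<le> g v"
            using le[of v] nz[of v] v * by (simp add: u_def sgn_div_norm field_simps)
          ultimately show "u t \<bullet> f v \<le> h v"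
            by (simp add: h_def inner_diff_left)
        qed
        finally show ?thesis .
      qed
      with d(1) show "\<exists>d>0. \<forall>s t. s \<le> y \<and> y \<le> t \<and> t - s < d \<longrightarrow>
          a \<le> s \<and> s \<le> t \<and> t \<le> b \<longrightarrow> norm (x t) - norm (x s) \<le> integral {s..t} h"
        by blast
    qed (use \<open>a \<le> b\<close> in auto)
    then show ?thesis
      using \<open>a \<le> b\<close> by (simp add: h_def[abs_def])
  qed
  show ?thesis
  proof (rule field_le_epsilon)
    fix e :: real assume "e > 0"
    define J where "J = integral {a..b} (\<lambda>v. norm (f v))"
    have "J \<ge> 0"
      unfolding J_def by (intro integral_nonneg f') auto
    \<comment> \<open>The denominator \<open>J + 1\<close> is positive even when
      \<open>J = 0\<close>, and it keeps the error term below \<open>e\<close>.\<close>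
    then have e': "e / (J + 1) > 0" "e / (J + 1) * J \<le> e"
      using \<open>e > 0\<close> by (auto simp: field_simps)
    have "norm (x b) - norm (x a) \<le> integral {a..b} (\<lambda>v. g v + e / (J + 1) * norm (f v))"
      using e'(1) by (rule approx)
    also have "\<dots> = integral {a..b} g + e / (J + 1) * J"
      unfolding J_def
      by (subst Henstock_Kurzweil_Integration.integral_add[OF g integrable_on_mult_right[OF f'(2)]]) simp
    finally show "norm (x b) - norm (x a) \<le> integral {a..b} g + e"
      using e'(2) by linarith
  qed
qed

section \<open>Real-variable lemmas for the barrier argument\<close>

lemma powr_dominates:
  fixes p q A B K a0 :: real
  assumes "p > q" "q \<ge> 1" "a0 > 0" "A \<ge> 0" "B \<ge> 0"
  shows "\<exists>c. c \<ge> 1 \<and> c \<ge> K \<and> A * (c + B + 1) powr q \<le> a0 * c powr p"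
proof -
  \<comment> \<open>From \<open>c \<ge> B + 1\<close> follows \<open>c + B + 1 \<le> 2 * c\<close>,
    so the claim reduces to \<open>Z \<le> c powr (p - q)\<close>. The last entry in the maximum
    defining \<open>c\<close> ensures this, by \<open>p > q\<close>.\<close>
  define Z where "Z = A * 2 powr q / a0"
  define c where "c = max (max 1 K) (max (B + 1) (Z powr (1 / (p - q))))"
  have c: "c \<ge> 1" "c \<ge> K" "c \<ge> B + 1" "c \<ge> Z powr (1 / (p - q))"
    by (auto simp: c_def)
  have Z: "Z \<ge> 0"
    using assms by (simp add: Z_def)
  have "Z = (Z powr (1 / (p - q))) powr (p - q)"
    using Z assms by (simp add: powr_powr)
  also have "\<dots> \<le> c powr (p - q)"
    using c assms by (intro powr_mono2) auto
  finally have *: "A * 2 powr q \<le> a0 * c powr (p - q)"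
    using assms by (simp add: Z_def field_simps)
  have "A * (c + B + 1) powr q \<le> A * (2 * c) powr q"
    using c assms by (intro mult_left_mono powr_mono2) auto
  also have "\<dots> = A * 2 powr q * c powr q"
    using c by (simp add: powr_mult)
  also have "\<dots> \<le> a0 * c powr (p - q) * c powr q"
    using * by (intro mult_right_mono) auto
  also have "\<dots> = a0 * c powr p"
    by (simp add: mult.assoc flip: powr_add)
  finally show ?thesis
    using c by blast
qed

text \<open>The superlevel set is compact, and its least element \<open>t\<close> is the hitting
  time: by the intermediate value theorem \<open>R\<close> is taken on \<open>[a, t]\<close>, and by
  minimality only at \<open>t\<close>.\<close>

lemma first_hitting_time:
  fixes h :: "real \<Rightarrow> real"
  assumes h: "continuous_on {a..b} h" and v: "v \<in> {a..b}" "h v \<ge> R" and "h a < R"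
  obtains t where "t \<in> {a..b}" "h t = R" "\<And>u. a \<le> u \<Longrightarrow> u \<le> t \<Longrightarrow> h u \<le> R"
proof -
  define S where "S = {a..b} \<inter> h -` {R..}"
  have "compact S"
    unfolding S_def compact_eq_bounded_closed
    by (intro conjI bounded_Int continuous_closed_preimage h) auto
  moreover have "S \<noteq> {}"
    using v by (auto simp: S_def)
  ultimately obtain t where t: "t \<in> S" "\<And>u. u \<in> S \<Longrightarrow> t \<le> u"
    using compact_attains_inf by metis
  have "continuous_on {a..t} h"
    using h t(1) by (rule_tac continuous_on_subset) (auto simp: S_def)
  then obtain w where "a \<le> w" "w \<le> t" "h w = R"
    using IVT'[of h a R t] \<open>h a < R\<close> t(1) by (auto simp: S_def)
  then have "h t = R"
    using t(1) t(2)[of w] by (auto simp: S_def)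
  moreover have "h u \<le> R" if "a \<le> u" "u \<le> t" for u
    using t(1) t(2)[of u] that \<open>h t = R\<close> by (cases "u = t") (auto simp: S_def not_less[symmetric])
  ultimately show thesis
    using that t(1) by (auto simp: S_def)
qed

text \<open>Time reversal and a change of sign turn the last visit into a first one.\<close>

lemma last_hitting_time:
  fixes h :: "real \<Rightarrow> real"
  assumes h: "continuous_on {a..b} h" and "a \<le> b" "h a \<le> c" "h b > c"
  obtains s where "s \<in> {a..b}" "h s = c" "\<And>u. s \<le> u \<Longrightarrow> u \<le> b \<Longrightarrow> h u \<ge> c"
proof -
  have "continuous_on {-b..-a} (\<lambda>u. - h (- u))"
    by (intro continuous_intros continuous_on_compose2[OF h]) auto
  then obtain t where t: "t \<in> {-b..-a}" "- h (- t) = - c" "\<And>u. -b \<le> u \<Longrightarrow> u \<le> t \<Longrightarrow> - h (- u) \<le> - c"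
    by (rule first_hitting_time[of "-b" "-a" _ "-a" "-c"]) (use assms in auto)
  show thesis
  proof (rule that[of "-t"])
    show "h u \<ge> c" if "- t \<le> u" "u \<le> b" for u
      using t(3)[of "-u"] that by simp
  qed (use t in auto)
qed

section \<open>The dissipative equation on bounded time intervals\<close>

locale dissipative_delay_equation = delay_equation r m F \<delta>
  for r :: real and m :: nat
    and F :: "nat \<Rightarrow> real \<Rightarrow> real ^ 'n \<Rightarrow> real ^ 'n" and \<delta> :: "nat \<Rightarrow> real \<Rightarrow> real" +
  fixes p q M N :: real and \<alpha> :: "nat \<Rightarrow> real" and \<beta> :: "nat \<Rightarrow> real \<Rightarrow> real"
  assumes F_Lipschitz: "\<And>i. i \<le> m \<Longrightarrow> locally_lipschitz_space (F i)"
    and p_q: "p > q" "q \<ge> 1"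
    and \<alpha>_pos: "\<And>i. i \<le> m \<Longrightarrow> \<alpha> i > 0"
    and \<beta>_measurable: "\<And>i. i \<le> m \<Longrightarrow> \<beta> i \<in> borel_measurable lebesgue"
    and \<beta>_nonneg: "\<And>i t. i \<le> m \<Longrightarrow> \<beta> i t \<ge> 0"
    and dissipation: "\<And>t x. F 0 t x \<bullet> x \<le> - \<alpha> 0 * norm x powr (p + 1) + \<beta> 0 t"
    and growth: "\<And>i t x. 1 \<le> i \<Longrightarrow> i \<le> m \<Longrightarrow> norm (F i t x) \<le> \<alpha> i * norm x powr q + \<beta> i t"
    and M_pos: "M > 0" and N_pos: "N > 0"
    and \<beta>_integral: "\<And>s t. s < t \<Longrightarrow>
      (\<Sum>i = 0..m. \<integral>\<^sup>+\<mu>\<in>{s..t}. ennreal (\<beta> i \<mu>) \<partial>lebesgue) \<le> ennreal (M * (t - s) + N)"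
begin

text \<open>Compactness of the ball and of the time interval turns the local Lipschitz bounds into
  one constant for each \<open>i\<close>.\<close>

lemma F_Lipschitz_on_cball:
  obtains L where "L \<ge> 0" "\<And>i s v w. i \<le> m \<Longrightarrow> s \<in> {a..b} \<Longrightarrow> norm v \<le> R \<Longrightarrow> norm w \<le> R \<Longrightarrow>
    norm (F i s v - F i s w) \<le> L * norm (v - w)"
proof -
  have "\<exists>L. \<forall>s\<in>{a..b}. L-lipschitz_on (cball 0 R) (F i s)" if i: "i \<le> m" for i
  proof -
    have "local_lipschitz {a..b} (cball 0 R) (F i)"
    proof (rule local_lipschitzI)
      fix t :: real and x :: "real ^ 'n"
      obtain u L where "u > 0" "\<And>s. s \<in> {a..b} \<Longrightarrow> L-lipschitz_on (cball x u) (F i s)"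
        using F_Lipschitz[OF i] unfolding locally_lipschitz_space_def by blast
      then show "\<exists>u>0. \<exists>L. \<forall>s\<in>cball t u \<inter> {a..b}. L-lipschitz_on (cball x u \<inter> cball 0 R) (F i s)"
        by (meson IntD2 inf_le1 lipschitz_on_subset)
    qed
    moreover have "continuous_on {a..b} (\<lambda>t. F i t x)" for x
      using continuous_on_compose2[OF F_continuous[OF i], of "{a..b}" "\<lambda>t. (t, x)"]
      by (simp add: continuous_on_Pair continuous_on_id continuous_on_const)
    ultimately show ?thesis
      using local_lipschitz_compact_implies_lipschitz[of "{a..b}" "cball 0 R" "F i"]
      by (metis compact_Icc compact_cball)
  qed
  then obtain L where L: "\<And>i s. i \<le> m \<Longrightarrow> s \<in> {a..b} \<Longrightarrow> (L i)-lipschitz_on (cball 0 R) (F i s)"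
    by metis
  show thesis
  proof (rule that)
    \<comment> \<open>The sum serves all \<open>i\<close> at once. The absolute values secure
      nonnegativity also when \<open>{a..b}\<close> is empty and nothing is known of
      \<open>L i\<close>.\<close>
    show "(\<Sum>i\<le>m. \<bar>L i\<bar>) \<ge> 0"
      by (simp add: sum_nonneg)
    fix i s and v w :: "real ^ 'n" assume *: "i \<le> m" "s \<in> {a..b}" "norm v \<le> R" "norm w \<le> R"
    then have "norm (F i s v - F i s w) \<le> L i * norm (v - w)"
      using lipschitz_onD[OF L[of i s], of v w] by (simp add: dist_norm)
    also have "\<dots> \<le> (\<Sum>i\<le>m. \<bar>L i\<bar>) * norm (v - w)"
    proof (rule mult_right_mono)
      have "L i \<le> \<bar>L i\<bar>"
        by simp
      also have "\<dots> \<le> (\<Sum>i\<le>m. \<bar>L i\<bar>)"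
        using * by (intro member_le_sum) auto
      finally show "L i \<le> (\<Sum>i\<le>m. \<bar>L i\<bar>)" .
    qed simp
    finally show "norm (F i s v - F i s w) \<le> (\<Sum>i\<le>m. \<bar>L i\<bar>) * norm (v - w)" .
  qed
qed

text \<open>The hypothesis bounds integrals valued in \<open>ennreal\<close>, which carries
  finiteness with it; a nonnegative measurable function with finite integral is gauge integrable
  with the same value.\<close>

lemma \<beta>_sum_integral:
  assumes "s \<le> t"
  shows "(\<lambda>\<mu>. \<Sum>i = 0..m. \<beta> i \<mu>) integrable_on {s..t}"
    "integral {s..t} (\<lambda>\<mu>. \<Sum>i = 0..m. \<beta> i \<mu>) \<le> M * (t - s) + N"
proof -
  define b where "b \<mu> = (\<Sum>i = 0..m. \<beta> i \<mu>)" for \<mu>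
  have b: "b \<mu> \<ge> 0" for \<mu>
    unfolding b_def using \<beta>_nonneg by (intro sum_nonneg) auto
  have "b integrable_on {s..t} \<and> integral {s..t} b \<le> M * (t - s) + N"
  proof (cases "s < t")
    case True
    have "(\<integral>\<^sup>+\<mu>. ennreal (if \<mu> \<in> {s..t} then b \<mu> else 0) \<partial>lebesgue)
        = (\<integral>\<^sup>+\<mu>. (\<Sum>i = 0..m. ennreal (\<beta> i \<mu>) * indicator {s..t} \<mu>) \<partial>lebesgue)"
    proof (rule nn_integral_cong)
      fix \<mu>
      have "ennreal (b \<mu>) = (\<Sum>i = 0..m. ennreal (\<beta> i \<mu>))"
        unfolding b_def using \<beta>_nonneg by (intro sum_ennreal[symmetric]) auto
      then show "ennreal (if \<mu> \<in> {s..t} then b \<mu> else 0) = (\<Sum>i = 0..m. ennreal (\<beta> i \<mu>) * indicator {s..t} \<mu>)"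
        by (auto simp: indicator_def)
    qed
    also have "\<dots> = (\<Sum>i = 0..m. \<integral>\<^sup>+\<mu>\<in>{s..t}. ennreal (\<beta> i \<mu>) \<partial>lebesgue)"
      using \<beta>_measurable
      by (intro nn_integral_sum borel_measurable_times_ennreal borel_measurable_indicator
          measurable_compose[OF _ measurable_ennreal]) auto
    also have "\<dots> \<le> ennreal (M * (t - s) + N)"
      using True by (rule \<beta>_integral)
    finally have le: "(\<integral>\<^sup>+\<mu>. ennreal (if \<mu> \<in> {s..t} then b \<mu> else 0) \<partial>lebesgue) \<le> ennreal (M * (t - s) + N)" .
    then obtain I where I: "I \<ge> 0" "(\<integral>\<^sup>+\<mu>. ennreal (if \<mu> \<in> {s..t} then b \<mu> else 0) \<partial>lebesgue) = ennreal I"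
      by (cases "\<integral>\<^sup>+\<mu>. ennreal (if \<mu> \<in> {s..t} then b \<mu> else 0) \<partial>lebesgue" rule: ennreal_cases)
         (auto simp: top_unique)
    have "b \<in> borel_measurable lebesgue"
      unfolding b_def using \<beta>_measurable by (intro borel_measurable_sum) auto
    then have "(\<lambda>\<mu>. if \<mu> \<in> {s..t} then b \<mu> else 0) \<in> borel_measurable lebesgue"
      by (intro measurable_If_set) auto
    then have "((\<lambda>\<mu>. if \<mu> \<in> {s..t} then b \<mu> else 0) has_integral I) UNIV"
      using I b by (subst has_integral_iff_nn_integral_lebesgue) auto
    then have "(b has_integral I) {s..t}"
      by (simp only: has_integral_restrict_UNIV)
    moreover have "I \<le> M * (t - s) + N"
    proof -
      have "M * (t - s) + N \<ge> 0"
        using M_pos N_pos True by (simp add: add_nonneg_nonneg)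
      then show ?thesis
        using le unfolding I(2) by (simp only: ennreal_le_iff)
    qed
    ultimately show ?thesis
      by (auto simp: has_integral_integrable integral_unique)
  next
    case False
    \<comment> \<open>The hypothesis speaks of \<open>s < t\<close> only; over a point the integral
      is 0, which is below \<open>N\<close>.\<close>
    then have "s = t" using assms by simp
    then show ?thesis
      using N_pos integrable_on_refl[of b t] by simp
  qed
  then show "(\<lambda>\<mu>. \<Sum>i = 0..m. \<beta> i \<mu>) integrable_on {s..t}"
    "integral {s..t} (\<lambda>\<mu>. \<Sum>i = 0..m. \<beta> i \<mu>) \<le> M * (t - s) + N"
    by (simp_all add: b_def[abs_def])
qed

text \<open>Where \<open>\<bar>x\<bar>\<close> is at least \<open>c\<close>, the dissipation beats the delayed terms, which are at most
  of order \<open>R\<close> to the power \<open>q\<close>, so that only the \<open>\<beta> i\<close> can make \<open>\<bar>x\<bar>\<close> grow.\<close>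

lemma solves_norm_bound:
  assumes x: "solves \<tau> T x" and "\<tau> \<le> T"
    and c: "c \<ge> 1" "(\<Sum>i = 1..m. \<alpha> i) * R powr q \<le> \<alpha> 0 * c powr p"
    and R: "\<And>u. u \<in> {\<tau> - r..T} \<Longrightarrow> norm (x u) \<le> R"
    and init: "norm (x \<tau>) \<le> c"
  shows "norm (x T) \<le> c + M * (T - \<tau>) + N"
proof (cases "norm (x T) \<le> c")
  case True
  then show ?thesis
    using M_pos N_pos \<open>\<tau> \<le> T\<close> by (smt (verit) mult_nonneg_nonneg)
next
  case False
  define b where "b \<mu> = (\<Sum>i = 0..m. \<beta> i \<mu>)" for \<mu>
  have cont: "continuous_on {\<tau>..T} (\<lambda>u. norm (x u))"
    using solves_continuous[OF x] r_nonneg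
    by (intro continuous_on_norm) (auto elim: continuous_on_subset)
  have "norm (x T) > c"
    using False by simp
  then obtain s where s: "s \<in> {\<tau>..T}" "norm (x s) = c" "\<And>u. s \<le> u \<Longrightarrow> u \<le> T \<Longrightarrow> norm (x u) \<ge> c"
    using last_hitting_time[OF cont \<open>\<tau> \<le> T\<close> init] by blast
  have xs: "solves s T x"
    using x s(1) by (auto intro: solves_restart[of \<tau> T x s])
  have "norm (x T) - norm (x s) \<le> integral {s..T} b"
  proof (rule norm_increment_le_integral)
    show "s \<le> T"
      using s by simp
    show "rhs x absolutely_integrable_on {s..T}"
      using solves_continuous[OF xs] by (rule rhs_absolutely_integrable)
    show "x v - x u = integral {u..v} (rhs x)" if "s \<le> u" "u \<le> v" "v \<le> T" for u v
      using solves_increment[OF xs] that by blast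
    show "continuous_on {s..T} x"
      using continuous_on_subset[OF solves_continuous[OF xs]] r_nonneg by auto
    show "x t \<noteq> 0" if "t \<in> {s..T}" for t
      using s(3)[of t] that c(1) by auto
    show "b integrable_on {s..T}"
      unfolding b_def using s by (intro \<beta>_sum_integral) auto
    fix t assume t: "t \<in> {s..T}"
    define y where "y = norm (x t)"
    have y: "y \<ge> c" "y \<ge> 1"
      using s(3)[of t] t c(1) by (auto simp: y_def)
    have "F i t (x (t - \<delta> i t)) \<bullet> x t \<le> (\<alpha> i * R powr q + \<beta> i t) * y" if i: "i \<in> {1..m}" for i
    proof -
      have "norm (F i t (x (t - \<delta> i t))) \<le> \<alpha> i * norm (x (t - \<delta> i t)) powr q + \<beta> i t"
        using i by (intro growth) auto
      also have "\<dots> \<le> \<alpha> i * R powr q + \<beta> i t"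
        using i t s(1) delay_range[of i t] p_q \<alpha>_pos[of i]
        by (intro add_right_mono mult_left_mono powr_mono2 R) auto
      finally have "norm (F i t (x (t - \<delta> i t))) * y \<le> (\<alpha> i * R powr q + \<beta> i t) * y"
        using y by (intro mult_right_mono) auto
      then show ?thesis
        using norm_cauchy_schwarz[of "F i t (x (t - \<delta> i t))" "x t"] by (simp add: y_def)
    qed
    then have "(\<Sum>i = 1..m. F i t (x (t - \<delta> i t)) \<bullet> x t) \<le> (\<Sum>i = 1..m. (\<alpha> i * R powr q + \<beta> i t) * y)"
      by (rule sum_mono)
    also have "\<dots> = ((\<Sum>i = 1..m. \<alpha> i) * R powr q + (\<Sum>i = 1..m. \<beta> i t)) * y"
      by (simp add: sum.distrib flip: sum_distrib_right)
    also have "\<dots> \<le> (\<alpha> 0 * y powr p + (\<Sum>i = 1..m. \<beta> i t)) * y"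
    proof (intro mult_right_mono add_right_mono)
      have "\<alpha> 0 * c powr p \<le> \<alpha> 0 * y powr p"
        using y c(1) p_q \<alpha>_pos[of 0] by (intro mult_left_mono powr_mono2) auto
      then show "(\<Sum>i = 1..m. \<alpha> i) * R powr q \<le> \<alpha> 0 * y powr p"
        using c(2) by linarith
    qed (use y in auto)
    finally have 1: "(\<Sum>i = 1..m. F i t (x (t - \<delta> i t)) \<bullet> x t) \<le> (\<alpha> 0 * y powr p + (\<Sum>i = 1..m. \<beta> i t)) * y" .
    have "y powr (p + 1) = y powr p * y"
      using y by (simp add: powr_add)
    then have 2: "F 0 t (x t) \<bullet> x t \<le> - \<alpha> 0 * (y powr p * y) + \<beta> 0 t"
      using dissipation[of t "x t"] by (simp add: y_def)
    \<comment> \<open>A factor \<open>y\<close> has to be split off from every term; for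
      \<open>\<beta> 0 t\<close> it is inserted at no cost because \<open>y \<ge> 1\<close>.\<close>
    have 3: "\<beta> 0 t \<le> \<beta> 0 t * y"
      using \<beta>_nonneg[of 0 t] y mult_left_mono[of 1 y "\<beta> 0 t"] by simp
    have "x t \<bullet> rhs x t = F 0 t (x t) \<bullet> x t + (\<Sum>i = 1..m. F i t (x (t - \<delta> i t)) \<bullet> x t)"
      by (simp add: dde_rhs_def inner_commute[of "x t"] inner_add_left inner_sum_left)
    also have "\<dots> \<le> (\<beta> 0 t + (\<Sum>i = 1..m. \<beta> i t)) * y"
      using 1 2 3 by (simp add: algebra_simps)
    also have "\<beta> 0 t + (\<Sum>i = 1..m. \<beta> i t) = b t"
      by (simp add: b_def sum.atLeast_Suc_atMost)
    finally show "x t \<bullet> rhs x t \<le> norm (x t) * b t"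
      by (simp add: y_def mult.commute)
  qed
  also have "\<dots> \<le> M * (T - s) + N"
    unfolding b_def using s by (intro \<beta>_sum_integral) auto
  also have "\<dots> \<le> M * (T - \<tau>) + N"
    using s M_pos by simp
  finally show ?thesis
    using s(2) by simp
qed

text \<open>The nearest-point projection onto the ball \<open>S\<close> is 1-Lipschitz, so
  \<open>G\<close> is globally Lipschitz with the constant of \<open>F\<close> on \<open>S\<close>.
  Its solution solves the original equation until it leaves \<open>S\<close>, and the a priori bound
  rules out that it does.\<close>

lemma solves_exists:
  assumes \<phi>: "continuous_on {-r..0} \<phi>" and "\<tau> \<le> T"
  shows "\<exists>x. solves \<tau> T x \<and> (\<forall>s\<in>{-r..0}. x (\<tau> + s) = \<phi> s)"
proof -
  obtain K where K: "\<And>s. s \<in> {-r..0} \<Longrightarrow> norm (\<phi> s) \<le> K"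
    using compact_imp_bounded[OF compact_continuous_image[OF \<phi> compact_Icc]]
    by (metis bounded_iff image_eqI)
  define B where "B = M * (T - \<tau>) + N"
  have B: "B \<ge> 0"
    using M_pos N_pos \<open>\<tau> \<le> T\<close> by (simp add: B_def add_nonneg_nonneg)
  have "(\<Sum>i = 1..m. \<alpha> i) \<ge> 0"
    using \<alpha>_pos by (intro sum_nonneg) (auto simp: less_imp_le)
  then obtain c where c: "c \<ge> 1" "c \<ge> K" "(\<Sum>i = 1..m. \<alpha> i) * (c + B + 1) powr q \<le> \<alpha> 0 * c powr p"
    using powr_dominates[OF p_q \<alpha>_pos[of 0] _ B] by blast
  \<comment> \<open>The history stays below \<open>c\<close> and the growth up to \<open>T\<close>
    is at most \<open>B\<close>; the extra 1 puts the exit level strictly above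
    \<open>c + B\<close>.\<close>
  define R where "R = c + B + 1"
  define S where "S = cball (0 :: real ^ 'n) R"
  define G where "G i t v = F i t (closest_point S v)" for i t v
  have S: "convex S" "closed S" "S \<noteq> {}"
    using c B by (auto simp: S_def R_def)
  have G_F: "G i t v = F i t v" if "norm v \<le> R" for i t v
    using that by (simp add: G_def S_def closest_point_self)
  have norm_S: "norm (closest_point S v) \<le> R" for v
    using closest_point_in_set[OF S(2,3), of v] by (simp add: S_def)
  interpret G: delay_equation r m G \<delta>
  proof
    fix i assume "i \<le> m"
    from continuous_on_compose2[OF F_continuous[OF this], of UNIV "\<lambda>z. (fst z, closest_point S (snd z))"]
    show "continuous_on UNIV (\<lambda>(t, x). G i t x)"
      using S by (simp add: G_def case_prod_unfold continuous_on_Pair continuous_on_fst continuous_on_id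
          continuous_on_compose2[OF continuous_on_closest_point[of S UNIV] continuous_on_snd[OF continuous_on_id]])
  qed (use r_nonneg delay_measurable delay_range in auto)
  obtain L where L: "L \<ge> 0" "\<And>i s v w. i \<le> m \<Longrightarrow> s \<in> {\<tau>..T} \<Longrightarrow> norm v \<le> R \<Longrightarrow> norm w \<le> R \<Longrightarrow>
      norm (F i s v - F i s w) \<le> L * norm (v - w)"
    using F_Lipschitz_on_cball by blast
  have "norm (G i s v - G i s w) \<le> L * norm (v - w)" if "i \<le> m" "s \<in> {\<tau>..T}" for i s v w
  proof -
    have "norm (G i s v - G i s w) \<le> L * norm (closest_point S v - closest_point S w)"
      unfolding G_def using that norm_S by (intro L)
    also have "\<dots> \<le> L * norm (v - w)"
      using closest_point_lipschitz[OF S, of v w] L(1) by (intro mult_left_mono) (auto simp: dist_norm)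
    finally show ?thesis .
  qed
  from G.solves_exists_global_Lipschitz[OF \<phi> \<open>\<tau> \<le> T\<close> L(1) this]
  obtain x where x: "G.solves \<tau> T x" "\<And>s. s \<in> {-r..0} \<Longrightarrow> x (\<tau> + s) = \<phi> s"
    by blast
  \<comment> \<open>The bound is asked only up to \<open>t\<close>, so this applies first up to a
    supposed exit time and, once exit is excluded, up to \<open>T\<close>.\<close>
  have untruncated: "solves \<tau> t x"
    if t: "\<tau> \<le> t" "t \<le> T" and R: "\<And>u. u \<in> {\<tau> - r..t} \<Longrightarrow> norm (x u) \<le> R" for t
    unfolding solves_def
  proof (intro conjI ballI)
    show "continuous_on {\<tau> - r..t} x"
      using G.solves_continuous[OF x(1)] t by (auto elim: continuous_on_subset)
    fix v assume v: "v \<in> {\<tau>..t}"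
    have "rhs x s = G.rhs x s" if s: "s \<in> {\<tau>..v}" for s
    proof -
      have "norm (x (s - \<delta> i s)) \<le> R" if "i \<in> {1..m}" for i
        using delay_range[of i s] that s v by (intro R) auto
      moreover have "norm (x s) \<le> R"
        using s v r_nonneg by (intro R) auto
      ultimately show ?thesis
        by (simp add: dde_rhs_def G_F)
    qed
    then have "integral {\<tau>..v} (rhs x) = integral {\<tau>..v} (G.rhs x)"
      by (rule integral_cong)
    then show "x v = x \<tau> + integral {\<tau>..v} (rhs x)"
      using G.solves_eq[OF x(1), of v] v t by simp
  qed
  have init: "norm (x u) \<le> c" if "u \<in> {\<tau> - r..\<tau>}" for u
    using x(2)[of "u - \<tau>"] K[of "u - \<tau>"] c(2) that by auto
  have "norm (x u) < R" if u: "u \<in> {\<tau>..T}" for u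
  proof (rule ccontr)
    assume "\<not> norm (x u) < R"
    moreover have "continuous_on {\<tau>..T} (\<lambda>u. norm (x u))"
      using G.solves_continuous[OF x(1)] r_nonneg
      by (intro continuous_on_norm) (auto elim: continuous_on_subset)
    moreover have "norm (x \<tau>) < R"
      using init[of \<tau>] r_nonneg B by (simp add: R_def)
    ultimately obtain t where t: "t \<in> {\<tau>..T}" "norm (x t) = R"
        "\<And>v. \<tau> \<le> v \<Longrightarrow> v \<le> t \<Longrightarrow> norm (x v) \<le> R"
      using first_hitting_time[of \<tau> T "\<lambda>u. norm (x u)" u R] u by (auto simp: not_less)
    have R': "norm (x v) \<le> R" if "v \<in> {\<tau> - r..t}" for v
      using init[of v] t(3)[of v] that B by (cases "v \<le> \<tau>") (auto simp: R_def)
    have "norm (x t) \<le> c + M * (t - \<tau>) + N"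
    proof (rule solves_norm_bound[where R = R])
      show "solves \<tau> t x"
        using t R' by (intro untruncated) auto
    qed (use t c R' init[of \<tau>] r_nonneg in \<open>auto simp: R_def\<close>)
    also have "\<dots> \<le> c + B"
      using t(1) M_pos by (simp add: B_def)
    finally show False
      using t(2) by (simp add: R_def)
  qed
  moreover have "norm (x u) \<le> R" if "u \<in> {\<tau> - r..\<tau>}" for u
    using init[OF that] B by (simp add: R_def)
  ultimately have "norm (x u) \<le> R" if "u \<in> {\<tau> - r..T}" for u
    using that by (cases "u \<le> \<tau>") (auto simp: less_imp_le)
  then have "solves \<tau> T x"
    using \<open>\<tau> \<le> T\<close> by (intro untruncated) auto
  with x(2) show ?thesis by blast
qed

text \<open>Both solutions stay in a common ball, where a Lipschitz constant exists, so stability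
  applies with initial difference 0.\<close>

lemma solves_unique:
  assumes x: "solves \<tau> T x" and y: "solves \<tau> T y" and "\<tau> \<le> T"
    and init: "\<And>u. u \<in> {\<tau> - r..\<tau>} \<Longrightarrow> x u = y u" and t: "t \<in> {\<tau> - r..T}"
  shows "x t = y t"
proof -
  have "\<exists>R. \<forall>u\<in>{\<tau> - r..T}. norm (z u) \<le> R" if "solves \<tau> T z" for z
    using compact_imp_bounded[OF compact_continuous_image[OF solves_continuous[OF that] compact_Icc]]
    by (simp add: bounded_iff)
  then obtain R\<^sub>x R\<^sub>y where R: "\<And>u. u \<in> {\<tau> - r..T} \<Longrightarrow> norm (x u) \<le> R\<^sub>x"
      "\<And>u. u \<in> {\<tau> - r..T} \<Longrightarrow> norm (y u) \<le> R\<^sub>y"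
    using x y by meson
  obtain L where L: "L \<ge> 0" "\<And>i s v w. i \<le> m \<Longrightarrow> s \<in> {\<tau>..T} \<Longrightarrow> norm v \<le> max R\<^sub>x R\<^sub>y \<Longrightarrow>
      norm w \<le> max R\<^sub>x R\<^sub>y \<Longrightarrow> norm (F i s v - F i s w) \<le> L * norm (v - w)"
    using F_Lipschitz_on_cball by blast
  have "norm (x t - y t) \<le> 2 * 0 * exp ((2 * L * real (m + 1) + 1) * (T - \<tau>))"
    using R L init by (intro solves_stable[OF x y \<open>\<tau> \<le> T\<close> _ _ _ t]) (auto simp: le_max_iff_disj)
  then show ?thesis
    by simp
qed

section \<open>Global solutions and well-definedness of \<open>dde_sol\<close>\<close>

lemma dde_solution_exists:
  assumes \<phi>: "continuous_on {-r..0} \<phi>"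
  shows "\<exists>x. dde_solution r m F \<delta> \<tau> \<phi> x"
proof -
  have "\<exists>x. solves \<tau> (\<tau> + real n) x \<and> (\<forall>s\<in>{-r..0}. x (\<tau> + s) = \<phi> s)" for n
    by (intro solves_exists \<phi>) auto
  then obtain X where X: "\<And>n. solves \<tau> (\<tau> + real n) (X n)" "\<And>n s. s \<in> {-r..0} \<Longrightarrow> X n (\<tau> + s) = \<phi> s"
    by metis
  have X_init: "X n u = \<phi> (u - \<tau>)" if "u \<in> {\<tau> - r..\<tau>}" for n u
    using X(2)[of "u - \<tau>" n] that by auto
  have agree: "X k u = X n u" if "k \<le> n" "u \<in> {\<tau> - r..\<tau> + real k}" for k n u
  proof (rule solves_unique[OF X(1) _ _ _ that(2)])
    show "solves \<tau> (\<tau> + real k) (X n)"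
      using X(1) by (rule solves_subinterval) (use that in auto)
  qed (simp_all add: X_init)
  \<comment> \<open>By uniqueness the solutions \<open>X n\<close> on growing intervals extend each
    other, so any index beyond \<open>u - \<tau>\<close> gives the same value. For \<open>u\<close>
    in the history the ceiling is not positive and \<open>nat\<close> selects
    \<open>X 0\<close>.\<close>
  define x where "x u = X (nat \<lceil>u - \<tau>\<rceil>) u" for u
  have x: "x u = X n u" if "u \<in> {\<tau> - r..\<tau> + real n}" for n u
  proof -
    have "u - \<tau> \<le> real (nat \<lceil>u - \<tau>\<rceil>)"
      by (rule real_nat_ceiling_ge)
    moreover have "nat \<lceil>u - \<tau>\<rceil> \<le> n"
      using that by (simp add: nat_le_iff ceiling_le_iff)
    ultimately show ?thesis
      unfolding x_def using that by (intro agree) auto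
  qed
  have "solves \<tau> T x" if "\<tau> \<le> T" for T
  proof -
    obtain n where n: "T - \<tau> \<le> real n"
      using real_arch_simple by blast
    have "solves \<tau> (\<tau> + real n) x"
      using X(1)[of n] by (rule solves_cong) (use x in auto)
    then show ?thesis
      by (rule solves_subinterval) (use n in auto)
  qed
  moreover have "x (\<tau> + s) = \<phi> s" if "s \<in> {-r..0}" for s
    using x[of "\<tau> + s" 0] X(2)[OF that] that by auto
  ultimately show ?thesis
    unfolding dde_solution_iff_solves by blast
qed

lemma dde_solution_unique:
  assumes x: "dde_solution r m F \<delta> \<tau> \<phi> x" and y: "dde_solution r m F \<delta> \<tau> \<phi> y" and "t \<ge> \<tau> - r"
  shows "x t = y t"
proof (rule solves_unique)
  show "solves \<tau> (max \<tau> t) x" "solves \<tau> (max \<tau> t) y"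
    using x y by (auto simp: dde_solution_iff_solves)
  show "x u = y u" if "u \<in> {\<tau> - r..\<tau>}" for u
  proof -
    have "u - \<tau> \<in> {-r..0}"
      using that by auto
    then have "x (\<tau> + (u - \<tau>)) = y (\<tau> + (u - \<tau>))"
      using x y unfolding dde_solution_iff_solves by metis
    then show ?thesis by simp
  qed
qed (use \<open>t \<ge> \<tau> - r\<close> in auto)

text \<open>Restricting a solution to \<open>{\<tau> - r..}\<close> fixes its arbitrary values
  further left, so exactly one function qualifies for the \<open>THE\<close> in
  \<open>dde_sol\<close>.\<close>

lemma dde_sol_solution:
  assumes "continuous_on {-r..0} \<phi>"
  shows "dde_solution r m F \<delta> \<tau> \<phi> (dde_sol r m F \<delta> \<tau> \<phi>)"
proof -
  obtain x where x: "dde_solution r m F \<delta> \<tau> \<phi> x"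
    using dde_solution_exists[OF assms] by blast
  have "dde_solution r m F \<delta> \<tau> \<phi> (restrict x {\<tau> - r..})"
    using x unfolding dde_solution_iff_solves
    by (auto elim!: solves_cong)
  then have "\<exists>!x. x \<in> extensional {\<tau> - r..} \<and> dde_solution r m F \<delta> \<tau> \<phi> x"
    by (intro ex1I[of _ "restrict x {\<tau> - r..}"])
       (auto intro!: extensionalityI[of _ "{\<tau> - r..}"] dde_solution_unique)
  from theI'[OF this] show ?thesis
    by (simp add: dde_sol_def)
qed

end

section \<open>The process of the delay equation\<close>

lemma mspace_history_spaceD:
  assumes "\<phi> \<in> mspace (history_space r)"
  shows "continuous_on {-r..0} \<phi>" "\<phi> \<in> extensional {-r..0}"
  using assms by (auto simp: mspace_history_space)

lemma norm_le_hist_norm: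
  assumes "continuous_on {-r..0} \<phi>" "s \<in> {-r..0}"
  shows "norm (\<phi> s) \<le> hist_norm r \<phi>"
  unfolding hist_norm_def using assms
  by (intro cSUP_upper bounded_imp_bdd_above compact_imp_bounded compact_continuous_image continuous_on_norm) auto

lemma hist_norm_leI:
  assumes "r \<ge> 0" "\<And>s. s \<in> {-r..0} \<Longrightarrow> norm (\<phi> s) \<le> K"
  shows "hist_norm r \<phi> \<le> K"
  unfolding hist_norm_def using assms by (intro cSUP_least) auto

lemma hist_norm_nonneg:
  assumes "r \<ge> 0" "continuous_on {-r..0} \<phi>"
  shows "hist_norm r \<phi> \<ge> 0"
  by (rule order_trans[OF norm_ge_zero norm_le_hist_norm[OF assms(2), of 0]]) (use assms in auto)

lemma mdist_history_space_leI:
  assumes "r \<ge> 0" "\<phi> \<in> mspace (history_space r)" "\<psi> \<in> mspace (history_space r)"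
    and "\<And>s. s \<in> {-r..0} \<Longrightarrow> norm (\<phi> s - \<psi> s) \<le> K"
  shows "mdist (history_space r) \<phi> \<psi> \<le> K"
  unfolding mdist_history_space[OF assms(1-3)] using assms by (intro hist_norm_leI)

lemma norm_diff_le_mdist_history_space:
  assumes "r \<ge> 0" "\<phi> \<in> mspace (history_space r)" "\<psi> \<in> mspace (history_space r)" "s \<in> {-r..0}"
  shows "norm (\<phi> s - \<psi> s) \<le> mdist (history_space r) \<phi> \<psi>"
  unfolding mdist_history_space[OF assms(1-3)]
  by (rule norm_le_hist_norm[OF continuous_on_diff]) (use assms in \<open>auto dest: mspace_history_spaceD\<close>)

section \<open>The solution process and its cocycle law\<close>

context dissipative_delay_equation
begin

abbreviation H :: "(real \<Rightarrow> real ^ 'n) metric" where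
  "H \<equiv> history_space r"

abbreviation sol :: "real \<Rightarrow> (real \<Rightarrow> real ^ 'n) \<Rightarrow> real \<Rightarrow> real ^ 'n" where
  "sol \<equiv> dde_sol r m F \<delta>"

abbreviation process :: "real \<Rightarrow> real \<Rightarrow> (real \<Rightarrow> real ^ 'n) \<Rightarrow> (real \<Rightarrow> real ^ 'n)" where
  "process \<equiv> dde_process r m F \<delta>"

lemma sol_solves:
  assumes "\<phi> \<in> mspace H" "\<tau> \<le> T"
  shows "solves \<tau> T (sol \<tau> \<phi>)"
  using dde_sol_solution[OF mspace_history_spaceD(1)[OF assms(1)]] assms(2)
  by (simp add: dde_solution_iff_solves)

lemma sol_init:
  assumes "\<phi> \<in> mspace H" "u \<in> {\<tau> - r..\<tau>}"
  shows "sol \<tau> \<phi> u = \<phi> (u - \<tau>)"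
proof -
  have "u - \<tau> \<in> {-r..0}"
    using assms(2) by auto
  then have "sol \<tau> \<phi> (\<tau> + (u - \<tau>)) = \<phi> (u - \<tau>)"
    using dde_sol_solution[OF mspace_history_spaceD(1)[OF assms(1)], of \<tau>]
    unfolding dde_solution_iff_solves by blast
  then show ?thesis by simp
qed

lemma sol_eqI:
  assumes "\<phi> \<in> mspace H" "dde_solution r m F \<delta> \<tau> \<phi> x" "t \<ge> \<tau> - r"
  shows "sol \<tau> \<phi> t = x t"
  using dde_sol_solution[OF mspace_history_spaceD(1)[OF assms(1)]] assms(2,3)
  by (rule dde_solution_unique)

lemma process_apply: "s \<in> {-r..0} \<Longrightarrow> process t \<tau> \<phi> s = sol \<tau> \<phi> (t + s)"
  by (simp add: dde_process_def)

lemma process_closed: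
  assumes "\<tau> \<le> t" "\<phi> \<in> mspace H"
  shows "process t \<tau> \<phi> \<in> mspace H"
proof -
  have "continuous_on {-r..0} (\<lambda>s. sol \<tau> \<phi> (t + s))"
    using assms by (intro continuous_on_compose2[OF solves_continuous[OF sol_solves[OF assms(2,1)]]]
        continuous_intros) auto
  then show ?thesis
    by (auto simp: mspace_history_space dde_process_def cong: continuous_on_cong_simp)
qed

text \<open>The solution from \<open>\<tau>\<close> also solves the equation from \<open>s\<close>
  on with its own history at \<open>s\<close>, so uniqueness identifies it with the restarted
  one.\<close>

lemma process_compose:
  assumes "\<tau> \<le> s" "s \<le> t" "\<phi> \<in> mspace H"
  shows "process t s (process s \<tau> \<phi>) = process t \<tau> \<phi>"
proof -
  have "solves s T (sol \<tau> \<phi>)" if "s \<le> T" for T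
    using assms that by (intro solves_restart[OF sol_solves]) auto
  then have "dde_solution r m F \<delta> s (process s \<tau> \<phi>) (sol \<tau> \<phi>)"
    unfolding dde_solution_iff_solves by (simp add: process_apply)
  then have "sol s (process s \<tau> \<phi>) (t + u) = sol \<tau> \<phi> (t + u)" if "u \<in> {-r..0}" for u
    using that assms process_closed by (intro sol_eqI) auto
  then show ?thesis
    by (auto simp: dde_process_def)
qed

end

section \<open>Continuity and asymptotic compactness of the process\<close>

locale bounded_dissipative_delay_equation = dissipative_delay_equation r m F \<delta> p q M N \<alpha> \<beta>
  for r :: real and m :: nat
    and F :: "nat \<Rightarrow> real \<Rightarrow> real ^ 'n \<Rightarrow> real ^ 'n" and \<delta> :: "nat \<Rightarrow> real \<Rightarrow> real"
    and p q M N :: real and \<alpha> :: "nat \<Rightarrow> real" and \<beta> :: "nat \<Rightarrow> real \<Rightarrow> real" +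
  fixes C lam \<rho> :: real
  assumes C_pos: "C > 0" and lam_pos: "lam > 0"
    and sol_estimate: "\<And>\<tau> \<phi> t. \<phi> \<in> mspace (history_space r) \<Longrightarrow> t \<ge> \<tau> \<Longrightarrow>
      norm (dde_sol r m F \<delta> \<tau> \<phi> t) \<le> C * hist_norm r \<phi> * exp (- lam * (t - \<tau>)) + \<rho>"
begin

lemma sol_bounded:
  assumes "\<phi> \<in> mspace H" "hist_norm r \<phi> \<le> K" "t \<ge> \<tau>"
  shows "norm (sol \<tau> \<phi> t) \<le> C * K + \<rho>"
proof -
  have "hist_norm r \<phi> \<ge> 0"
    using hist_norm_nonneg r_nonneg mspace_history_spaceD(1)[OF assms(1)] by blast
  then have "C * hist_norm r \<phi> * exp (- lam * (t - \<tau>)) \<le> C * K * 1"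
    using assms C_pos lam_pos by (intro mult_mono) auto
  then show ?thesis
    using sol_estimate[OF assms(1,3)] by simp
qed

text \<open>Histories within distance 1 of \<open>l\<close> produce solutions in one common ball,
  where a single Lipschitz constant serves all; \<open>solves_stable\<close> then bounds the
  distance at time \<open>t\<close> by a fixed multiple of the initial one.\<close>

lemma process_continuous:
  assumes "\<tau> \<le> t" and f: "\<And>n. f n \<in> mspace H" and l: "l \<in> mspace H"
    and lim: "(\<lambda>n. mdist H (f n) l) \<longlonglongrightarrow> 0"
  shows "(\<lambda>n. mdist H (process t \<tau> (f n)) (process t \<tau> l)) \<longlonglongrightarrow> 0"
proof -
  define K where "K = hist_norm r l + 1"
  \<comment> \<open>\<open>K\<close> bounds the histories, \<open>C * K + \<rho>\<close> the
    solutions after \<open>\<tau>\<close>.\<close>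
  define R where "R = max K (C * K + \<rho>)"
  obtain L where L: "L \<ge> 0" "\<And>i s v w. i \<le> m \<Longrightarrow> s \<in> {\<tau>..t} \<Longrightarrow> norm v \<le> R \<Longrightarrow> norm w \<le> R \<Longrightarrow>
      norm (F i s v - F i s w) \<le> L * norm (v - w)"
    using F_Lipschitz_on_cball by blast
  define E where "E = exp ((2 * L * real (m + 1) + 1) * (t - \<tau>))"
  have bounded: "norm (sol \<tau> \<phi> u) \<le> R"
    if "\<phi> \<in> mspace H" "hist_norm r \<phi> \<le> K" "u \<ge> \<tau> - r" for \<phi> u
  proof (cases "u \<ge> \<tau>")
    case True
    then show ?thesis
      using sol_bounded[OF that(1,2)] by (simp add: R_def le_max_iff_disj)
  next
    case False
    then have "norm (sol \<tau> \<phi> u) \<le> hist_norm r \<phi>"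
      using that sol_init[of \<phi> u \<tau>] norm_le_hist_norm[OF mspace_history_spaceD(1)[OF that(1)], of "u - \<tau>"]
      by auto
    then show ?thesis
      using that by (simp add: R_def)
  qed
  have near: "mdist H (process t \<tau> \<phi>) (process t \<tau> l) \<le> 2 * mdist H \<phi> l * E"
    if \<phi>: "\<phi> \<in> mspace H" "mdist H \<phi> l < 1" for \<phi>
  proof (rule mdist_history_space_leI[OF r_nonneg process_closed process_closed])
    have "hist_norm r \<phi> \<le> K"
    proof (rule hist_norm_leI[OF r_nonneg])
      fix s assume s: "s \<in> {-r..0}"
      have "norm (\<phi> s) \<le> norm (l s) + norm (\<phi> s - l s)"
        using norm_triangle_sub by blast
      then show "norm (\<phi> s) \<le> K"
        using norm_diff_le_mdist_history_space[OF r_nonneg \<phi>(1) l s] \<phi>(2)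
          norm_le_hist_norm[OF mspace_history_spaceD(1)[OF l] s] by (simp add: K_def)
    qed
    then have R: "norm (sol \<tau> \<phi> u) \<le> R" "norm (sol \<tau> l u) \<le> R" if "u \<ge> \<tau> - r" for u
      using that bounded l \<phi>(1) by (auto simp: K_def)
    fix s assume s: "s \<in> {-r..0}"
    have "norm (sol \<tau> \<phi> (t + s) - sol \<tau> l (t + s)) \<le> 2 * mdist H \<phi> l * E"
      unfolding E_def
    proof (rule solves_stable[OF sol_solves[OF \<phi>(1)] sol_solves[OF l]])
      show "norm (sol \<tau> \<phi> u - sol \<tau> l u) \<le> mdist H \<phi> l" if "u \<in> {\<tau> - r..\<tau>}" for u
        using that norm_diff_le_mdist_history_space[OF r_nonneg \<phi>(1) l, of "u - \<tau>"]
        by (auto simp: sol_init \<phi>(1) l)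
    qed (use assms s L R in auto)
    then show "norm (process t \<tau> \<phi> s - process t \<tau> l s) \<le> 2 * mdist H \<phi> l * E"
      using s by (simp add: process_apply)
  qed (use assms \<phi> in auto)
  have "\<forall>\<^sub>F n in sequentially. mdist H (f n) l < 1"
    using order_tendstoD(2)[OF lim] by simp
  then have "\<forall>\<^sub>F n in sequentially. norm (mdist H (process t \<tau> (f n)) (process t \<tau> l)) \<le> 2 * mdist H (f n) l * E"
    by eventually_elim (use near f in auto)
  moreover have "(\<lambda>n. 2 * mdist H (f n) l * E) \<longlonglongrightarrow> 0"
    using tendsto_mult_right[OF tendsto_mult_left[OF lim, of 2], of E] by simp
  ultimately show ?thesis
    by (rule Lim_null_comparison)
qed

lemma process_asymptotically_compact:
  assumes \<sigma>: "filterlim \<sigma> at_bot sequentially" and f: "\<And>n. f n \<in> mspace H"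
    and K: "\<And>n. hist_norm r (f n) \<le> K"
  shows "\<exists>k l. strict_mono (k :: nat \<Rightarrow> nat) \<and> l \<in> mspace H \<and>
    (\<lambda>n. mdist H (process t (\<sigma> (k n)) (f (k n))) l) \<longlonglongrightarrow> 0"
proof -
  \<comment> \<open>On \<open>[t - r, t]\<close> the right-hand side reads values back to
    \<open>t - 2 * r\<close>; an earlier start places all of them under the bound
    \<open>R\<close>.\<close>
  have "\<forall>\<^sub>F n in sequentially. \<sigma> n \<le> t - 2 * r"
    using \<sigma> by (simp add: filterlim_at_bot)
  then obtain n0 where n0: "\<And>n. n \<ge> n0 \<Longrightarrow> \<sigma> n \<le> t - 2 * r"
    by (auto simp: eventually_sequentially)
  define x where "x n = sol (\<sigma> (n + n0)) (f (n + n0))" for n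
  define R where "R = C * K + \<rho>"
  have start: "\<sigma> (n + n0) \<le> t - 2 * r" for n
    using n0 by simp
  have R: "norm (x n u) \<le> R" if "u \<ge> t - 2 * r" for n u
    unfolding x_def R_def using that start[of n] by (intro sol_bounded f K) auto
  have solves: "solves (\<sigma> (n + n0)) t (x n)" for n
    unfolding x_def using start[of n] r_nonneg by (intro sol_solves f) auto
  obtain D where D: "D \<ge> 0"
      "\<And>y s. s \<in> {t - r..t} \<Longrightarrow> (\<And>u. u \<in> {s - r..s} \<Longrightarrow> norm (y u) \<le> R) \<Longrightarrow> norm (rhs y s) \<le> D"
    using rhs_bounded[of "t - r" t R] by blast
  have increment: "norm (x n b - x n a) \<le> D * (b - a)" if "t - r \<le> a" "a \<le> b" "b \<le> t" for n a b
  proof -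
    have "x n b - x n a = integral {a..b} (rhs (x n))"
      using that start[of n] r_nonneg by (intro solves_increment[OF solves]) auto
    also have "norm \<dots> \<le> integral {a..b} (\<lambda>_. D)"
    proof (rule integral_norm_bound_integral)
      show "rhs (x n) integrable_on {a..b}"
        using that start[of n] r_nonneg
        by (intro rhs_integrable[OF solves_continuous[OF solves]]) auto
      show "norm (rhs (x n) s) \<le> D" if "s \<in> {a..b}" for s
        using that \<open>t - r \<le> a\<close> \<open>b \<le> t\<close> by (intro D(2) R) auto
    qed auto
    finally show ?thesis
      using that by (simp add: mult.commute)
  qed
  have Lip: "norm (x n (t + u) - x n (t + v)) \<le> D * \<bar>u - v\<bar>" if "u \<in> {-r..0}" "v \<in> {-r..0}" for n u v
    using increment[of "t + u" "t + v" n] increment[of "t + v" "t + u" n] that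
    by (cases "u \<le> v") (auto simp: norm_minus_commute)
  obtain g k where g: "continuous_on {-r..0} g" "strict_mono (k :: nat \<Rightarrow> nat)"
      "\<And>e. 0 < e \<Longrightarrow> \<exists>N. \<forall>n s. n \<ge> N \<and> s \<in> {-r..0} \<longrightarrow> norm (x (k n) (t + s) - g s) < e"
  proof (rule Arzela_Ascoli[of "{-r..0}" "\<lambda>n s. x n (t + s)" R])
    show "norm (x n (t + s)) \<le> R" if "s \<in> {-r..0}" for n s
      using that r_nonneg by (intro R) auto
    fix u e :: real assume u: "u \<in> {-r..0}" "0 < e"
    \<comment> \<open>The denominator \<open>D + 1\<close> allows for \<open>D = 0\<close>.\<close>
    have "norm (x n (t + u) - x n (t + v)) < e" if "v \<in> {-r..0}" "norm (u - v) < e / (D + 1)" for n v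
    proof -
      have "norm (x n (t + u) - x n (t + v)) \<le> D * \<bar>u - v\<bar>"
        using u that by (intro Lip) auto
      also have "\<dots> \<le> (D + 1) * \<bar>u - v\<bar>"
        by (intro mult_right_mono) auto
      also have "\<dots> < e"
        using that(2) D(1) by (simp add: field_simps)
      finally show ?thesis .
    qed
    then show "\<exists>d>0. \<forall>n v. v \<in> {-r..0} \<and> norm (u - v) < d \<longrightarrow> norm (x n (t + u) - x n (t + v)) < e"
      using u D(1) by (intro exI[of _ "e / (D + 1)"]) auto
  qed (use that in auto)
  \<comment> \<open>Restriction makes the limit extensional, as elements of the phase space
    are.\<close>
  define l where "l = restrict g {-r..0}"
  have l: "l \<in> mspace H"
    using g(1) by (auto simp: l_def mspace_history_space cong: continuous_on_cong_simp)
  define j where "j n = k n + n0" for n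
  have "(\<lambda>n. mdist H (process t (\<sigma> (j n)) (f (j n))) l) \<longlonglongrightarrow> 0"
  proof (rule LIMSEQ_I)
    fix e :: real assume "e > 0"
    then obtain n1 where n1: "\<And>n s. n \<ge> n1 \<Longrightarrow> s \<in> {-r..0} \<Longrightarrow> norm (x (k n) (t + s) - g s) < e / 2"
      using g(3)[of "e / 2"] by auto
    have "mdist H (process t (\<sigma> (j n)) (f (j n))) l < e" if "n \<ge> n1" for n
    proof -
      have "mdist H (process t (\<sigma> (j n)) (f (j n))) l \<le> e / 2"
      proof (rule mdist_history_space_leI[OF r_nonneg process_closed l])
        show "\<sigma> (j n) \<le> t"
          using start[of "k n"] r_nonneg by (simp add: j_def)
        show "norm (process t (\<sigma> (j n)) (f (j n)) s - l s) \<le> e / 2" if "s \<in> {-r..0}" for s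
          using n1[OF \<open>n \<ge> n1\<close> that] that by (simp add: process_apply x_def j_def l_def)
      qed (rule f)
      then show ?thesis
        using \<open>e > 0\<close> by simp
    qed
    then show "\<exists>n1. \<forall>n\<ge>n1. norm (mdist H (process t (\<sigma> (j n)) (f (j n))) l - 0) < e"
      by auto
  qed
  moreover have "strict_mono j"
    using g(2) by (auto simp: j_def strict_mono_def)
  ultimately show ?thesis
    using l by blast
qed

text \<open>For fixed \<open>s\<close> the exponential term of the estimate decays as
  \<open>\<sigma> n\<close> tends to \<open>-\<infinity>\<close> and leaves exactly
  \<open>\<rho>\<close>; this confines the attractor to the \<open>\<rho>\<close>-ball.\<close>

lemma process_limit_bound:
  assumes \<sigma>: "filterlim \<sigma> at_bot sequentially" and f: "\<And>n. f n \<in> mspace H"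
    and K: "\<And>n. hist_norm r (f n) \<le> K" and l: "l \<in> mspace H"
    and lim: "(\<lambda>n. mdist H (process t (\<sigma> n) (f n)) l) \<longlonglongrightarrow> 0"
  shows "hist_norm r l \<le> \<rho>"
proof (rule hist_norm_leI[OF r_nonneg])
  fix s assume s: "s \<in> {-r..0}"
  \<comment> \<open>The estimate holds only after the initial time; this start puts
    \<open>t + s\<close> there for every \<open>s\<close> in \<open>[- r, 0]\<close>.\<close>
  have "\<forall>\<^sub>F n in sequentially. \<sigma> n \<le> t - r"
    using \<sigma> by (simp add: filterlim_at_bot)
  then have "\<forall>\<^sub>F n in sequentially. norm (l s) \<le>
      C * K * exp (- lam * (t + s - \<sigma> n)) + \<rho> + mdist H (process t (\<sigma> n) (f n)) l"
  proof eventually_elim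
    case (elim n)
    then have n: "\<sigma> n \<le> t + s" "\<sigma> n \<le> t"
      using s r_nonneg by auto
    have "norm (l s) \<le> norm (sol (\<sigma> n) (f n) (t + s)) + norm (process t (\<sigma> n) (f n) s - l s)"
      using norm_triangle_sub[of "l s" "process t (\<sigma> n) (f n) s"] s
      by (simp add: process_apply norm_minus_commute)
    moreover have "norm (process t (\<sigma> n) (f n) s - l s) \<le> mdist H (process t (\<sigma> n) (f n)) l"
      using n s f l by (intro norm_diff_le_mdist_history_space r_nonneg process_closed)
    moreover have "norm (sol (\<sigma> n) (f n) (t + s)) \<le> C * hist_norm r (f n) * exp (- lam * (t + s - \<sigma> n)) + \<rho>"
      using n by (intro sol_estimate f)
    moreover have "C * hist_norm r (f n) * exp (- lam * (t + s - \<sigma> n)) \<le> C * K * exp (- lam * (t + s - \<sigma> n))"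
      using C_pos K by (intro mult_right_mono mult_left_mono) auto
    ultimately show ?case by linarith
  qed
  moreover have "(\<lambda>n. C * K * exp (- lam * (t + s - \<sigma> n)) + \<rho> + mdist H (process t (\<sigma> n) (f n)) l)
      \<longlonglongrightarrow> C * K * 0 + \<rho> + 0"
  proof (intro tendsto_intros lim)
    have "filterlim (\<lambda>n. lam * \<sigma> n) at_bot sequentially"
      by (rule filterlim_tendsto_pos_mult_at_bot[OF tendsto_const lam_pos \<sigma>])
    then have "filterlim (\<lambda>n. - lam * (t + s) + lam * \<sigma> n) at_bot sequentially"
      by (simp only: filterlim_tendsto_add_at_bot_iff[OF tendsto_const])
    then have "((\<lambda>n. exp (- lam * (t + s) + lam * \<sigma> n)) \<longlongrightarrow> 0) sequentially"
      by (rule filterlim_compose[OF exp_at_bot])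
    then show "(\<lambda>n. exp (- lam * (t + s - \<sigma> n))) \<longlonglongrightarrow> 0"
      by (simp add: algebra_simps)
  qed
  ultimately have "norm (l s) \<le> C * K * 0 + \<rho> + 0"
    by (intro tendsto_lowerbound) auto
  then show "norm (l s) \<le> \<rho>"
    by simp
qed

sublocale pullback_process H process "hist_norm r" \<rho>
proof
  show "mspace H \<noteq> {}"
  proof -
    have "restrict (\<lambda>_. 0) {-r..0} \<in> mspace H"
      by (auto simp: mspace_history_space cong: continuous_on_cong_simp)
    then show ?thesis by blast
  qed
qed (fact process_closed process_compose process_continuous process_asymptotically_compact
      process_limit_bound)+

end

theorem theorem3p8:
  fixes r p q C lam \<rho> M N :: real
    and m :: nat
    and F :: "nat \<Rightarrow> real \<Rightarrow> real ^ 'n \<Rightarrow> real ^ 'n"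
    and \<delta> :: "nat \<Rightarrow> real \<Rightarrow> real"
    and \<alpha> :: "nat \<Rightarrow> real"
    and \<beta> :: "nat \<Rightarrow> real \<Rightarrow> real"
  assumes "r \<ge> 0"
    and "\<And>i. i \<le> m \<Longrightarrow> continuous_on UNIV (\<lambda>(t, x). F i t x)"
    and "\<And>i. i \<le> m \<Longrightarrow> locally_lipschitz_space (F i)"
    and "\<And>i. 1 \<le> i \<Longrightarrow> i \<le> m \<Longrightarrow> \<delta> i \<in> borel_measurable lebesgue"
    and "\<And>i t. 1 \<le> i \<Longrightarrow> i \<le> m \<Longrightarrow> \<delta> i t \<in> {0..r}"
    and "p > q" and "q \<ge> 1"
    and "\<And>i. i \<le> m \<Longrightarrow> \<alpha> i > 0"
    and "\<And>i. i \<le> m \<Longrightarrow> \<beta> i \<in> borel_measurable lebesgue"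
    and "\<And>i t. i \<le> m \<Longrightarrow> \<beta> i t \<ge> 0"
    and "\<And>t x. F 0 t x \<bullet> x \<le> - \<alpha> 0 * norm x powr (p + 1) + \<beta> 0 t"
    and "\<And>i t x. 1 \<le> i \<Longrightarrow> i \<le> m \<Longrightarrow> norm (F i t x) \<le> \<alpha> i * norm x powr q + \<beta> i t"
    and "M > 0" and "N > 0"
    and "\<And>s t. s < t \<Longrightarrow>
           (\<Sum>i = 0..m. \<integral>\<^sup>+\<mu>\<in>{s..t}. ennreal (\<beta> i \<mu>) \<partial>lebesgue) \<le> ennreal (M * (t - s) + N)"
    and "C > 0" and "lam > 0" and "\<rho> > 0"
    and "\<And>\<tau> \<phi> t. \<phi> \<in> mspace (history_space r) \<Longrightarrow> t \<ge> \<tau> \<Longrightarrow>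
           norm (dde_sol r m F \<delta> \<tau> \<phi> t) \<le> C * hist_norm r \<phi> * exp (- lam * (t - \<tau>)) + \<rho>"
  shows "\<exists>!A :: real \<Rightarrow> (real \<Rightarrow> real ^ 'n) set.
           (\<forall>t. compactin (mtopology_of (history_space r)) (A t) \<and> A t \<subseteq> hist_cball r \<rho>) \<and>
           (\<forall>\<tau> t. t \<ge> \<tau> \<longrightarrow> dde_process r m F \<delta> t \<tau> ` A \<tau> = A t) \<and>
           (\<forall>B. B \<subseteq> mspace (history_space r) \<and> (\<exists>K. \<forall>\<phi>\<in>B. hist_norm r \<phi> \<le> K) \<longrightarrow>
              (\<forall>t. ((\<lambda>\<tau>. hausdorff_semidist (history_space r) (dde_process r m F \<delta> t \<tau> ` B) (A t))
                      \<longlongrightarrow> 0) at_bot))"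
proof -
  interpret bounded_dissipative_delay_equation r m F \<delta> p q M N \<alpha> \<beta> C lam \<rho>
    by unfold_locales (fact assms)+
  \<comment> \<open>\<open>hist_cball r \<rho>\<close> unfolds to the set of states of size at most
    \<open>\<rho>\<close> in the abstract theorem.\<close>
  show ?thesis
    using pullback_attractor_unique_exists by (simp only: hist_cball_def)
qed

end
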